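(* For every $0<\lambda<1/2$ and every $1\leq s\leq\infty$ there exist hyperbolic pseudo-affine IFSs $\Phi\subseteq C^s([0,1])$ with slope $\lambda$ such that $\Phi\not\subseteq C^t([0,1])$ for every $t>s$ (in the case $s=\infty$ this means that $\Phi$ is $C^\infty$ but not real analytic). Moreover, in each degree of regularity $1\leq s\leq\infty$ the following hold: (a) there exist such IFSs $\Phi$ that are $C^s$-conjugated to a self-similar IFS; (b) there exist such IFSs $\Phi$ that are not $C^s$-conjugated to any self-similar IFS.
   Context: Regularity. For an integer $r\ge 1$ and $0<\alpha\le 1$, a map $g:[0,1]\to\mathbb{R}$ is of class $C^{r,\alpha}$ if its derivatives up to order $r$ exist and are continuous and the $r$-th derivative is $\alpha$-Hölder (Lipschitz if $\alpha=1$). For real $s>1$, "class $C^s$" means class $C^{r,\alpha}$ where $s=r+\alpha$, $r\geq 1$ an integer, $0<\alpha\le 1$ (so for an integer $s\ge 2$ it means $C^{s-1,1}$). For $s=1$ it means continuously differentiable, and for $s=\infty$ it means smooth. A $C^s$ diffeomorphism is a bijection that is $C^s$ together with its inverse. IFS. A hyperbolic IFS of class $C^s$ is a pair $\Phi=\{f_0,f_1\}\subset C^s([0,1])$ of maps of $[0,1]$ into itself with $0<\inf_{t\in[0,1]}|f_i'(t)|\le\sup_{t\in[0,1]}|f_i'(t)|<1$ for $i=0,1$ and $0=f_0(0)<f_0(1)<f_1(0)<f_1(1)=1$. Its attractor $X_\Phi$ is the unique nonempty compact set $X\subseteq[0,1]$ with $X=f_0(X)\cup f_1(X)$. The IFS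 $\Phi$ is pseudo-affine with slope $\lambda$ if $f'(x)=\lambda$ for all $x\in X_\Phi$ and all $f\in\Phi$. An IFS is self-similar if all its maps are affine. $\Phi$ is $C^s$-conjugated to another IFS $\widetilde\Phi$ if there is a $C^s$ diffeomorphism $h$ of $[0,1]$ with $\widetilde\Phi=\{h\circ f_i\circ h^{-1}\}_{i=0,1}$. $\Phi\subseteq C^t([0,1])$ means that all maps of $\Phi$ are of class $C^t$. *)

theory Defs
  imports "HOL-Analysis.Analysis"
begin

text \<open>
  Maps of the unit interval are total functions on the reals of which only the values on
  \<open>{0..1}\<close> matter; derivatives are taken within \<open>{0..1}\<close>, hence one-sided at the endpoints.
\<close>

abbreviation unit_Icc :: "real set" where
  "unit_Icc \<equiv> {0..1}"

definition deriv_unit :: "(real \<Rightarrow> real) \<Rightarrow> real \<Rightarrow> real" where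
  "deriv_unit f = (\<lambda>x. vector_derivative f (at x within unit_Icc))"

definition C_nat :: "nat \<Rightarrow> (real \<Rightarrow> real) set" where
  "C_nat r = {f. (\<forall>k<r. (deriv_unit ^^ k) f differentiable_on unit_Icc) \<and>
                 (\<forall>k\<le>r. continuous_on unit_Icc ((deriv_unit ^^ k) f))}"

definition holder_on :: "real \<Rightarrow> real set \<Rightarrow> (real \<Rightarrow> real) \<Rightarrow> bool" where
  "holder_on \<alpha> A g \<longleftrightarrow> (\<exists>C. \<forall>x\<in>A. \<forall>y\<in>A. \<bar>g x - g y\<bar> \<le> C * \<bar>x - y\<bar> powr \<alpha>)"

definition C_holder :: "nat \<Rightarrow> real \<Rightarrow> (real \<Rightarrow> real) set" where
  "C_holder r \<alpha> = {f \<in> C_nat r. holder_on \<alpha> unit_Icc ((deriv_unit ^^ r) f)}"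

text \<open>
  For an integer \<open>s \<ge> 2\<close> the last case forces \<open>r = s - 1\<close> and \<open>\<alpha> = 1\<close>: the class is
  \<open>C\<close> with exponents \<open>(s - 1, 1)\<close>, not the classical one. The set is empty for \<open>s < 1\<close>.
\<close>

definition C_class :: "ereal \<Rightarrow> (real \<Rightarrow> real) set" where
  "C_class s = {f.
     if s = \<infinity> then (\<forall>r. f \<in> C_nat r)
     else if s = 1 then f \<in> C_nat 1
     else (\<exists>r \<alpha>. 1 \<le> r \<and> 0 < \<alpha> \<and> \<alpha> \<le> 1 \<and> s = ereal (real r + \<alpha>) \<and> f \<in> C_holder r \<alpha>)}"

definition C_omega :: "(real \<Rightarrow> real) set" where
  "C_omega = {f. \<forall>x\<in>unit_Icc. \<exists>e>0. \<exists>a :: nat \<Rightarrow> real.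
     \<forall>y\<in>unit_Icc. \<bar>y - x\<bar> < e \<longrightarrow> (\<lambda>n. a n * (y - x) ^ n) sums f y}"

definition C_diffeo :: "ereal \<Rightarrow> (real \<Rightarrow> real) \<Rightarrow> bool" where
  "C_diffeo s h \<longleftrightarrow> bij_betw h unit_Icc unit_Icc \<and>
     h \<in> C_class s \<and> inv_into unit_Icc h \<in> C_class s"

definition hyperbolic_IFS :: "ereal \<Rightarrow> (real \<Rightarrow> real) set \<Rightarrow> bool" where
  "hyperbolic_IFS s \<Phi> \<longleftrightarrow> (\<exists>f\<^sub>0 f\<^sub>1. \<Phi> = {f\<^sub>0, f\<^sub>1} \<and>
     \<Phi> \<subseteq> C_class s \<and>
     (\<forall>f\<in>\<Phi>. f ` unit_Icc \<subseteq> unit_Icc \<and>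
        0 < (INF t\<in>unit_Icc. \<bar>deriv_unit f t\<bar>) \<and>
        (INF t\<in>unit_Icc. \<bar>deriv_unit f t\<bar>) \<le> (SUP t\<in>unit_Icc. \<bar>deriv_unit f t\<bar>) \<and>
        (SUP t\<in>unit_Icc. \<bar>deriv_unit f t\<bar>) < 1) \<and>
     0 = f\<^sub>0 0 \<and> f\<^sub>0 0 < f\<^sub>0 1 \<and> f\<^sub>0 1 < f\<^sub>1 0 \<and> f\<^sub>1 0 < f\<^sub>1 1 \<and> f\<^sub>1 1 = 1)"

definition attractor :: "(real \<Rightarrow> real) set \<Rightarrow> real set" where
  "attractor \<Phi> = (THE X. X \<noteq> {} \<and> compact X \<and> X \<subseteq> unit_Icc \<and> X = (\<Union>f\<in>\<Phi>. f ` X))"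

definition pseudo_affine :: "real \<Rightarrow> (real \<Rightarrow> real) set \<Rightarrow> bool" where
  "pseudo_affine c \<Phi> \<longleftrightarrow> (\<forall>f\<in>\<Phi>. \<forall>x\<in>attractor \<Phi>. deriv_unit f x = c)"

definition self_similar :: "(real \<Rightarrow> real) set \<Rightarrow> bool" where
  "self_similar \<Phi> \<longleftrightarrow> (\<forall>f\<in>\<Phi>. \<exists>a b. \<forall>x\<in>unit_Icc. f x = a * x + b)"

text \<open>
  Restricting to \<open>{0..1}\<close> compares the two sets as sets of maps of the unit interval. As the
  sets are unordered, an orientation-reversing \<open>h\<close> (which swaps the two maps) is allowed.
\<close>

definition C_conjugated :: "ereal \<Rightarrow> (real \<Rightarrow> real) set \<Rightarrow> (real \<Rightarrow> real) set \<Rightarrow> bool" where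
  "C_conjugated s \<Phi> \<Psi> \<longleftrightarrow> (\<exists>h. C_diffeo s h \<and>
     (\<lambda>g. restrict g unit_Icc) ` \<Psi> =
     (\<lambda>f. restrict (h \<circ> f \<circ> inv_into unit_Icc h) unit_Icc) ` \<Phi>)"

definition conjugated_to_self_similar :: "ereal \<Rightarrow> (real \<Rightarrow> real) set \<Rightarrow> bool" where
  "conjugated_to_self_similar s \<Phi> \<longleftrightarrow>
     (\<exists>\<Psi>. hyperbolic_IFS s \<Psi> \<and> self_similar \<Psi> \<and> C_conjugated s \<Phi> \<Psi>)"

definition no_more_regular :: "ereal \<Rightarrow> (real \<Rightarrow> real) set \<Rightarrow> bool" where
  "no_more_regular s \<Phi> \<longleftrightarrow>
     (if s = \<infinity> then \<not> \<Phi> \<subseteq> C_omega else (\<forall>t>s. \<not> \<Phi> \<subseteq> C_class t))"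

end

theory Submission
  imports Defs "HOL-Real_Asymp.Real_Asymp" "HOL-Complex_Analysis.Cauchy_Integral_Formula"
begin

text \<open>
  Both examples are built from one diffeomorphism \<open>h\<close> of the unit interval that differs from the
  identity only in the open gap \<open>{c<..<1 - c}\<close>. Write \<open>p\<^sub>0 x = c * x\<close> and
  \<open>p\<^sub>1 x = c * x + (1 - c)\<close> for the affine system with slope \<open>c\<close>. The images of both maps lie
  outside the gap, where \<open>h\<close> is the identity, so that \<open>h \<circ> p\<^sub>i = p\<^sub>i\<close>. Precomposing either map
  with a diffeomorphism of this kind does not change its image, and so the attractor still avoids
  the gap; there all derivatives equal \<open>c\<close>, and the system is pseudo-affine.

  The system \<open>{p\<^sub>0 \<circ> h, p\<^sub>1 \<circ> h}\<close> is conjugated to the affine one by \<open>h\<close> itself, because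
  \<open>h \<circ> (p\<^sub>i \<circ> h) = p\<^sub>i \<circ> h\<close>. The system \<open>{p\<^sub>0 \<circ> h, p\<^sub>1}\<close> is not conjugated to any self-similar
  one: a conjugacy \<open>k\<close> (reflected, if it reverses the orientation) linearizes the first map at its
  fixed point \<open>0\<close>, and the differentiable linearization with \<open>k 1 = 1\<close> is unique, which
  gives \<open>k = h\<close>; the same argument for the second map at its fixed point \<open>1\<close> gives that \<open>k\<close> is
  the identity (\<open>linearization_unique\<close>, \<open>not_conjugated_gap_IFS\<close>).

  It remains to choose \<open>h x = x + e * v x\<close> with a small \<open>e > 0\<close> and a bump \<open>v\<close> supported in the gap that
  is of class \<open>s\<close> but not better (\<open>ex_bump\<close>). For finite \<open>s = r + a\<close> (with
  \<open>0 < a \<le> 1\<close>, or \<open>r = 1\<close> and \<open>a = 0\<close>) the bump is an iterated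
  antiderivative of a function that is equal to a modulus of continuity \<open>w (x - p)\<close> to the right
  of a point \<open>p\<close> and vanishes to the left. Each integration step is preceded by subtracting a translate,
  which keeps the support compact and leaves the germ at \<open>p\<close> unchanged. The modulus is
  \<open>t powr a\<close> for \<open>a > 0\<close> and \<open>- 1 / ln t\<close> for \<open>s = 1\<close>. For \<open>s = \<infinity>\<close> the bump is
  \<open>exp (- 1 / ((x - p) * (q - x)))\<close>. That the inverse of \<open>h\<close> has the same regularity follows
  from closure of the Hoelder classes under products, compositions and reciprocals.
\<close>

section \<open>Derivatives and Hoelder classes on the unit interval\<close>

lemma deriv_unit_eqI:
  assumes "x \<in> unit_Icc" "(f has_real_derivative d) (at x within unit_Icc)"
  shows "deriv_unit f x = d"
  using vector_derivative_within_closed_interval[of 0 1 x f d] assms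
  by (simp add: deriv_unit_def has_real_derivative_iff_has_vector_derivative)

lemma differentiable_on_deriv_unit:
  assumes "f differentiable_on unit_Icc" "x \<in> unit_Icc"
  shows "(f has_real_derivative deriv_unit f x) (at x within unit_Icc)"
proof -
  obtain d where "(f has_real_derivative d) (at x within unit_Icc)"
    using assms by (meson differentiable_on_def real_differentiable_def)
  then show ?thesis using deriv_unit_eqI assms(2) by metis
qed

lemma deriv_unit_cong:
  assumes "\<And>x. x \<in> unit_Icc \<Longrightarrow> f x = g x" "x \<in> unit_Icc"
  shows "deriv_unit f x = deriv_unit g x"
proof -
  have "(f has_vector_derivative d) (at x within unit_Icc) \<longleftrightarrow>
        (g has_vector_derivative d) (at x within unit_Icc)" for d
    using has_vector_derivative_transform[OF assms(2), of f g d]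
      has_vector_derivative_transform[OF assms(2), of g f d] assms(1) by auto
  then show ?thesis by (simp add: deriv_unit_def vector_derivative_def)
qed

lemma holder_on_cong:
  assumes "\<And>x. x \<in> A \<Longrightarrow> f x = g x"
  shows "holder_on a A f \<longleftrightarrow> holder_on a A g"
  using assms by (auto simp: holder_on_def)

lemma holder_onE:
  assumes "holder_on a A f"
  obtains C where "C \<ge> 0" "\<And>x y. x \<in> A \<Longrightarrow> y \<in> A \<Longrightarrow> \<bar>f x - f y\<bar> \<le> C * \<bar>x - y\<bar> powr a"
proof -
  obtain C where C: "\<And>x y. x \<in> A \<Longrightarrow> y \<in> A \<Longrightarrow> \<bar>f x - f y\<bar> \<le> C * \<bar>x - y\<bar> powr a"
    using assms unfolding holder_on_def by blast
  have "\<bar>f x - f y\<bar> \<le> \<bar>C\<bar> * \<bar>x - y\<bar> powr a" if "x \<in> A" "y \<in> A" for x y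
    by (rule order_trans[OF C[OF that]]) (auto intro!: mult_right_mono)
  then show ?thesis using that[of "\<bar>C\<bar>"] by auto
qed

lemma C_nat_0: "f \<in> C_nat 0 \<longleftrightarrow> continuous_on unit_Icc f"
  by (simp add: C_nat_def)

lemma C_nat_Suc:
  "f \<in> C_nat (Suc r) \<longleftrightarrow> f differentiable_on unit_Icc \<and> deriv_unit f \<in> C_nat r"
proof
  assume "f \<in> C_nat (Suc r)"
  then have 1: "\<And>k. k < Suc r \<Longrightarrow> (deriv_unit ^^ k) f differentiable_on unit_Icc"
    and 2: "\<And>k. k \<le> Suc r \<Longrightarrow> continuous_on unit_Icc ((deriv_unit ^^ k) f)"
    by (auto simp: C_nat_def)
  show "f differentiable_on unit_Icc \<and> deriv_unit f \<in> C_nat r"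
    using 1[of 0] 1[of "Suc k" for k] 2[of "Suc k" for k]
    by (auto simp: C_nat_def funpow_Suc_right simp del: funpow.simps(2))
next
  assume *: "f differentiable_on unit_Icc \<and> deriv_unit f \<in> C_nat r"
  have "(deriv_unit ^^ k) f differentiable_on unit_Icc" if "k < Suc r" for k
    using * that by (cases k) (auto simp: C_nat_def funpow_Suc_right simp del: funpow.simps(2))
  moreover have "continuous_on unit_Icc ((deriv_unit ^^ k) f)" if "k \<le> Suc r" for k
    using * that
    by (cases k) (auto simp: C_nat_def funpow_Suc_right differentiable_imp_continuous_on
        simp del: funpow.simps(2))
  ultimately show "f \<in> C_nat (Suc r)" by (simp add: C_nat_def)
qed

lemma C_holder_0: "f \<in> C_holder 0 a \<longleftrightarrow> continuous_on unit_Icc f \<and> holder_on a unit_Icc f"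
  by (simp add: C_holder_def C_nat_0)

lemma C_holder_Suc:
  "f \<in> C_holder (Suc r) a \<longleftrightarrow> f differentiable_on unit_Icc \<and> deriv_unit f \<in> C_holder r a"
  by (auto simp: C_holder_def C_nat_Suc funpow_Suc_right simp del: funpow.simps(2))

lemma C_holder_cong:
  assumes "\<And>x. x \<in> unit_Icc \<Longrightarrow> f x = g x"
  shows "f \<in> C_holder r a \<longleftrightarrow> g \<in> C_holder r a"
  using assms
proof (induction r arbitrary: f g)
  case 0
  then show ?case
    using holder_on_cong[of unit_Icc f g a] continuous_on_cong[of unit_Icc unit_Icc f g]
    by (simp add: C_holder_0)
next
  case (Suc r)
  have "f differentiable_on unit_Icc \<longleftrightarrow> g differentiable_on unit_Icc"
    unfolding differentiable_on_def
    using Suc.prems by (metis differentiable_transform_within zero_less_one)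
  moreover have "deriv_unit f \<in> C_holder r a \<longleftrightarrow> deriv_unit g \<in> C_holder r a"
    by (rule Suc.IH) (use Suc.prems deriv_unit_cong in blast)
  ultimately show ?case by (simp add: C_holder_Suc)
qed

lemma C_holder_SucI:
  assumes "\<And>x. x \<in> unit_Icc \<Longrightarrow> (f has_real_derivative f' x) (at x within unit_Icc)"
    and "f' \<in> C_holder r a"
  shows "f \<in> C_holder (Suc r) a"
proof -
  have "f differentiable_on unit_Icc"
    using assms(1) by (meson differentiable_on_def real_differentiable_def)
  moreover have "deriv_unit f \<in> C_holder r a"
    using C_holder_cong[of "deriv_unit f" f' r a] deriv_unit_eqI assms by blast
  ultimately show ?thesis by (simp add: C_holder_Suc)
qed

lemma C_holder_SucE:
  assumes "f \<in> C_holder (Suc r) a"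
  obtains f' where "\<And>x. x \<in> unit_Icc \<Longrightarrow> (f has_real_derivative f' x) (at x within unit_Icc)"
    and "f' \<in> C_holder r a"
  using assms differentiable_on_deriv_unit by (auto simp: C_holder_Suc)

lemma C_holder_continuous: "f \<in> C_holder r a \<Longrightarrow> continuous_on unit_Icc f"
  by (cases r) (auto simp: C_holder_0 C_holder_Suc differentiable_imp_continuous_on)

lemma continuous_unit_bounded:
  assumes "continuous_on unit_Icc (f :: real \<Rightarrow> real)"
  obtains B where "B > 0" "\<And>x. x \<in> unit_Icc \<Longrightarrow> \<bar>f x\<bar> \<le> B"
proof -
  have "bounded (f ` unit_Icc)"
    using assms by (intro compact_imp_bounded compact_continuous_image) auto
  then show ?thesis using that unfolding bounded_pos by auto
qed

text \<open>
  Since \<open>0 powr 0 = 0\<close>, exponent zero in the Hoelder condition only says that the oscillation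
  is bounded, which is automatic for a continuous function on a compact interval. The classes of
  continuously differentiable functions are thus covered by the Hoelder classes with exponent \<open>0\<close>.
\<close>

lemma C_nat_eq_C_holder_0: "C_nat r = C_holder r 0"
proof -
  have "f \<in> C_nat r \<longleftrightarrow> f \<in> C_holder r 0" for f
  proof (induction r arbitrary: f)
    case 0
    show ?case
    proof (cases "continuous_on unit_Icc f")
      case True
      obtain B where B: "\<And>x. x \<in> unit_Icc \<Longrightarrow> \<bar>f x\<bar> \<le> B"
        using continuous_unit_bounded[OF True] by metis
      have "\<bar>f x - f y\<bar> \<le> (2 * B) * \<bar>x - y\<bar> powr 0" if "x \<in> unit_Icc" "y \<in> unit_Icc" for x y
        using B[OF that(1)] B[OF that(2)] by (cases "x = y") auto
      then have "holder_on 0 unit_Icc f" unfolding holder_on_def by blast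
      then show ?thesis using True by (simp add: C_nat_0 C_holder_0)
    qed (simp add: C_nat_0 C_holder_0)
  qed (simp add: C_nat_Suc C_holder_Suc)
  then show ?thesis by blast
qed

lemma holder_on_Lipschitz:
  assumes "\<And>x y. x \<in> unit_Icc \<Longrightarrow> y \<in> unit_Icc \<Longrightarrow> \<bar>f x - f y\<bar> \<le> L * \<bar>x - y\<bar>"
    and "a \<le> 1" "0 \<le> L"
  shows "holder_on a unit_Icc f"
proof -
  have "\<bar>f x - f y\<bar> \<le> L * \<bar>x - y\<bar> powr a" if "x \<in> unit_Icc" "y \<in> unit_Icc" for x y
  proof -
    have "\<bar>x - y\<bar> powr 1 \<le> \<bar>x - y\<bar> powr a" using that assms by (intro powr_mono') auto
    then have "L * \<bar>x - y\<bar> \<le> L * \<bar>x - y\<bar> powr a" using assms by (intro mult_left_mono) auto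
    then show ?thesis using assms(1)[OF that] by linarith
  qed
  then show ?thesis unfolding holder_on_def by blast
qed

lemma C_1_Lipschitz:
  assumes "f \<in> C_holder (Suc r) a"
  obtains L where "L \<ge> 0"
    "\<And>x y. x \<in> unit_Icc \<Longrightarrow> y \<in> unit_Icc \<Longrightarrow> \<bar>f x - f y\<bar> \<le> L * \<bar>x - y\<bar>"
proof -
  obtain f' where f': "\<And>x. x \<in> unit_Icc \<Longrightarrow> (f has_real_derivative f' x) (at x within unit_Icc)"
    and "f' \<in> C_holder r a" using assms by (rule C_holder_SucE) blast
  then obtain B where B: "B > 0" "\<And>x. x \<in> unit_Icc \<Longrightarrow> \<bar>f' x\<bar> \<le> B"
    using C_holder_continuous continuous_unit_bounded by metis
  have "\<bar>f x - f y\<bar> \<le> B * \<bar>x - y\<bar>" if "x \<in> unit_Icc" "y \<in> unit_Icc" for x y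
    using field_differentiable_bound[of unit_Icc f f' B x y] f' B that by auto
  then show ?thesis using that[of B] B by auto
qed

lemma C_holder_SucD:
  assumes "a \<le> 1" "f \<in> C_holder (Suc r) a" shows "f \<in> C_holder r a"
  using assms(2)
proof (induction r arbitrary: f)
  case 0
  then obtain L where "L \<ge> 0"
    "\<And>x y. x \<in> unit_Icc \<Longrightarrow> y \<in> unit_Icc \<Longrightarrow> \<bar>f x - f y\<bar> \<le> L * \<bar>x - y\<bar>"
    by (rule C_1_Lipschitz) blast
  then have "holder_on a unit_Icc f" using assms(1) by (intro holder_on_Lipschitz)
  then show ?case using 0 C_holder_continuous by (auto simp: C_holder_0)
next
  case (Suc r)
  then show ?case by (simp add: C_holder_Suc[of f])
qed

lemma C_holder_antimono:
  assumes "a \<le> 1" "r \<le> r'" "f \<in> C_holder r' a" shows "f \<in> C_holder r a"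
  using assms(2,3)
  by (induction r' rule: dec_induct) (auto dest: C_holder_SucD[OF assms(1)])

section \<open>Sums, products, compositions and reciprocals\<close>

lemma C_holder_const: "a \<le> 1 \<Longrightarrow> (\<lambda>_. k) \<in> C_holder r a"
proof (induction r arbitrary: k)
  case 0
  then show ?case by (auto simp: C_holder_0 intro: holder_on_Lipschitz[of _ 0])
next
  case (Suc r)
  show ?case by (rule C_holder_SucI[where f' = "\<lambda>_. 0"]) (use Suc in auto)
qed

lemma C_holder_ident: "a \<le> 1 \<Longrightarrow> (\<lambda>x. x) \<in> C_holder r a"
proof (cases r)
  case 0
  then show "a \<le> 1 \<Longrightarrow> ?thesis" by (auto simp: C_holder_0 intro: holder_on_Lipschitz[of _ 1])
next
  case (Suc r')
  then show "a \<le> 1 \<Longrightarrow> ?thesis"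
    by (auto intro!: C_holder_SucI[where f' = "\<lambda>_. 1"] C_holder_const derivative_eq_intros)
qed

lemma holder_on_add:
  assumes "holder_on a A f" "holder_on a A g"
  shows "holder_on a A (\<lambda>x. f x + g x)"
proof -
  obtain C where C: "\<And>x y. x \<in> A \<Longrightarrow> y \<in> A \<Longrightarrow> \<bar>f x - f y\<bar> \<le> C * \<bar>x - y\<bar> powr a"
    using holder_onE[OF assms(1)] by metis
  obtain D where D: "\<And>x y. x \<in> A \<Longrightarrow> y \<in> A \<Longrightarrow> \<bar>g x - g y\<bar> \<le> D * \<bar>x - y\<bar> powr a"
    using holder_onE[OF assms(2)] by metis
  have "\<bar>(f x + g x) - (f y + g y)\<bar> \<le> (C + D) * \<bar>x - y\<bar> powr a" if "x \<in> A" "y \<in> A" for x y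
    using C[OF that] D[OF that] by (simp add: algebra_simps)
  then show ?thesis unfolding holder_on_def by blast
qed

lemma C_holder_add:
  assumes "f \<in> C_holder r a" "g \<in> C_holder r a"
  shows "(\<lambda>x. f x + g x) \<in> C_holder r a"
  using assms
proof (induction r arbitrary: f g)
  case 0
  then show ?case by (auto simp: C_holder_0 intro: continuous_intros holder_on_add)
next
  case (Suc r)
  obtain f' where f': "\<And>x. x \<in> unit_Icc \<Longrightarrow> (f has_real_derivative f' x) (at x within unit_Icc)"
    "f' \<in> C_holder r a" using Suc.prems(1) by (rule C_holder_SucE) blast
  obtain g' where g': "\<And>x. x \<in> unit_Icc \<Longrightarrow> (g has_real_derivative g' x) (at x within unit_Icc)"
    "g' \<in> C_holder r a" using Suc.prems(2) by (rule C_holder_SucE) blast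
  show ?case
    by (rule C_holder_SucI[where f' = "\<lambda>x. f' x + g' x"])
      (use f' g' Suc.IH in \<open>auto intro: derivative_intros\<close>)
qed

lemma C_holder_mult:
  assumes "a \<le> 1" "f \<in> C_holder r a" "g \<in> C_holder r a"
  shows "(\<lambda>x. f x * g x) \<in> C_holder r a"
  using assms(2,3)
proof (induction r arbitrary: f g)
  case 0
  then have cont: "continuous_on unit_Icc f" "continuous_on unit_Icc g"
    by (auto simp: C_holder_0)
  obtain B where B: "B > 0" "\<And>x. x \<in> unit_Icc \<Longrightarrow> \<bar>f x\<bar> \<le> B"
    using continuous_unit_bounded[OF cont(1)] by metis
  obtain B' where B': "B' > 0" "\<And>x. x \<in> unit_Icc \<Longrightarrow> \<bar>g x\<bar> \<le> B'"
    using continuous_unit_bounded[OF cont(2)] by metis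
  obtain C where C: "C \<ge> 0"
      "\<And>x y. x \<in> unit_Icc \<Longrightarrow> y \<in> unit_Icc \<Longrightarrow> \<bar>f x - f y\<bar> \<le> C * \<bar>x - y\<bar> powr a"
    using 0 holder_onE by (metis C_holder_0)
  obtain D where D: "D \<ge> 0"
      "\<And>x y. x \<in> unit_Icc \<Longrightarrow> y \<in> unit_Icc \<Longrightarrow> \<bar>g x - g y\<bar> \<le> D * \<bar>x - y\<bar> powr a"
    using 0 holder_onE by (metis C_holder_0)
  have "\<bar>f x * g x - f y * g y\<bar> \<le> (B * D + B' * C) * \<bar>x - y\<bar> powr a"
    if xy: "x \<in> unit_Icc" "y \<in> unit_Icc" for x y
  proof -
    have "\<bar>f x * g x - f y * g y\<bar> = \<bar>f x * (g x - g y) + g y * (f x - f y)\<bar>"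
      by (simp add: algebra_simps)
    also have "\<dots> \<le> \<bar>f x\<bar> * \<bar>g x - g y\<bar> + \<bar>g y\<bar> * \<bar>f x - f y\<bar>"
      by (metis abs_mult abs_triangle_ineq)
    also have "\<dots> \<le> B * (D * \<bar>x - y\<bar> powr a) + B' * (C * \<bar>x - y\<bar> powr a)"
      using B(1) B'(1) B(2)[OF xy(1)] B'(2)[OF xy(2)] C(2)[OF xy] D(2)[OF xy]
      by (intro add_mono mult_mono) auto
    finally show ?thesis by (simp add: algebra_simps)
  qed
  then have "holder_on a unit_Icc (\<lambda>x. f x * g x)" unfolding holder_on_def by blast
  then show ?case using cont by (auto simp: C_holder_0 intro: continuous_intros)
next
  case (Suc r)
  obtain f' where f': "\<And>x. x \<in> unit_Icc \<Longrightarrow> (f has_real_derivative f' x) (at x within unit_Icc)"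
    "f' \<in> C_holder r a" using Suc.prems(1) by (rule C_holder_SucE) blast
  obtain g' where g': "\<And>x. x \<in> unit_Icc \<Longrightarrow> (g has_real_derivative g' x) (at x within unit_Icc)"
    "g' \<in> C_holder r a" using Suc.prems(2) by (rule C_holder_SucE) blast
  have "f \<in> C_holder r a" "g \<in> C_holder r a"
    using Suc.prems C_holder_SucD[OF assms(1)] by auto
  then have "(\<lambda>x. f' x * g x + g' x * f x) \<in> C_holder r a"
    using f' g' Suc.IH by (intro C_holder_add) auto
  then show ?case
    by (rule C_holder_SucI[rotated]) (use f' g' in \<open>auto intro: derivative_intros\<close>)
qed

lemma C_holder_affine:
  assumes "a \<le> 1" "f \<in> C_holder r a"
  shows "(\<lambda>x. m * f x + b) \<in> C_holder r a"
  by (rule C_holder_add[OF C_holder_mult[OF assms(1) C_holder_const[OF assms(1)] assms(2)]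
        C_holder_const[OF assms(1)]])

text \<open>
  The hypothesis that the inner function is continuously differentiable is needed only for order
  \<open>0\<close>, where a Hoelder condition survives composition with a Lipschitz function.
\<close>

lemma C_holder_compose:
  assumes a: "0 \<le> a" "a \<le> 1"
    and "f \<in> C_holder r a" "g \<in> C_holder r a" "g \<in> C_holder 1 0"
    and into: "\<And>x. x \<in> unit_Icc \<Longrightarrow> g x \<in> unit_Icc"
  shows "(\<lambda>x. f (g x)) \<in> C_holder r a"
  using assms(3,4)
proof (induction r arbitrary: f)
  case 0
  obtain L where L: "L \<ge> 0"
    "\<And>x y. x \<in> unit_Icc \<Longrightarrow> y \<in> unit_Icc \<Longrightarrow> \<bar>g x - g y\<bar> \<le> L * \<bar>x - y\<bar>"
    using C_1_Lipschitz[of g 0 0] assms(5) by auto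
  obtain C where C: "C \<ge> 0"
      "\<And>x y. x \<in> unit_Icc \<Longrightarrow> y \<in> unit_Icc \<Longrightarrow> \<bar>f x - f y\<bar> \<le> C * \<bar>x - y\<bar> powr a"
    using 0 holder_onE by (metis C_holder_0)
  have "\<bar>f (g x) - f (g y)\<bar> \<le> (C * L powr a) * \<bar>x - y\<bar> powr a"
    if xy: "x \<in> unit_Icc" "y \<in> unit_Icc" for x y
  proof -
    have "\<bar>f (g x) - f (g y)\<bar> \<le> C * \<bar>g x - g y\<bar> powr a"
      using C(2) into xy by blast
    also have "\<dots> \<le> C * (L * \<bar>x - y\<bar>) powr a"
      using L(2)[OF xy] a C(1) by (intro mult_left_mono powr_mono2) auto
    finally show ?thesis using L(1) by (simp add: powr_mult mult.assoc)
  qed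
  then have "holder_on a unit_Icc (\<lambda>x. f (g x))" unfolding holder_on_def by blast
  moreover have "continuous_on unit_Icc (\<lambda>x. f (g x))"
    by (rule continuous_on_compose2[of unit_Icc f]) (use 0 into in \<open>auto simp: C_holder_0\<close>)
  ultimately show ?case by (simp add: C_holder_0)
next
  case (Suc r)
  obtain f' where f': "\<And>x. x \<in> unit_Icc \<Longrightarrow> (f has_real_derivative f' x) (at x within unit_Icc)"
    "f' \<in> C_holder r a" using Suc.prems(1) by (rule C_holder_SucE) blast
  obtain g' where g': "\<And>x. x \<in> unit_Icc \<Longrightarrow> (g has_real_derivative g' x) (at x within unit_Icc)"
    "g' \<in> C_holder r a" using Suc.prems(2) by (rule C_holder_SucE) blast
  have "(\<lambda>x. f' (g x)) \<in> C_holder r a"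
    using Suc.IH[OF f'(2)] Suc.prems C_holder_SucD[OF a(2)] by auto
  then have "(\<lambda>x. f' (g x) * g' x) \<in> C_holder r a"
    using g'(2) by (rule C_holder_mult[OF a(2)])
  moreover have "((\<lambda>x. f (g x)) has_real_derivative f' (g x) * g' x) (at x within unit_Icc)"
    if x: "x \<in> unit_Icc" for x
  proof -
    have "(f has_real_derivative f' (g x)) (at (g x) within g ` unit_Icc)"
      using f'(1)[OF into[OF x]] into by (rule_tac DERIV_subset) auto
    from DERIV_image_chain[OF this g'(1)[OF x]] show ?thesis by (simp add: o_def)
  qed
  ultimately show ?case by (intro C_holder_SucI)
qed

lemma C_holder_inverse:
  assumes a: "0 \<le> a" "a \<le> 1" and "f \<in> C_holder r a"
    and m: "m > 0" "\<And>x. x \<in> unit_Icc \<Longrightarrow> m \<le> f x"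
  shows "(\<lambda>x. inverse (f x)) \<in> C_holder r a"
  using assms(3,5)
proof (induction r arbitrary: f)
  case 0
  obtain C where C: "C \<ge> 0"
      "\<And>x y. x \<in> unit_Icc \<Longrightarrow> y \<in> unit_Icc \<Longrightarrow> \<bar>f x - f y\<bar> \<le> C * \<bar>x - y\<bar> powr a"
    using 0 holder_onE by (metis C_holder_0)
  have "\<bar>inverse (f x) - inverse (f y)\<bar> \<le> (C / (m * m)) * \<bar>x - y\<bar> powr a"
    if xy: "x \<in> unit_Icc" "y \<in> unit_Icc" for x y
  proof -
    have f: "m \<le> f x" "m \<le> f y" using 0(2) xy by auto
    have "\<bar>inverse (f x) - inverse (f y)\<bar> = \<bar>f x - f y\<bar> / (f x * f y)"
      using f m(1) by (simp add: inverse_eq_divide divide_simps abs_minus_commute)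
    also have "\<dots> \<le> (C * \<bar>x - y\<bar> powr a) / (m * m)"
      using C(2)[OF xy] f m(1) C(1) by (intro frac_le mult_mono) auto
    finally show ?thesis by simp
  qed
  then have "holder_on a unit_Icc (\<lambda>x. inverse (f x))" unfolding holder_on_def by blast
  moreover have "continuous_on unit_Icc (\<lambda>x. inverse (f x))"
    using 0 m(1) by (intro continuous_on_inverse) (force simp: C_holder_0)+
  ultimately show ?case by (simp add: C_holder_0)
next
  case (Suc r)
  obtain f' where f': "\<And>x. x \<in> unit_Icc \<Longrightarrow> (f has_real_derivative f' x) (at x within unit_Icc)"
    "f' \<in> C_holder r a" using Suc.prems(1) by (rule C_holder_SucE) blast
  have "(\<lambda>x. inverse (f x)) \<in> C_holder r a"
    using Suc.IH Suc.prems C_holder_SucD[OF a(2)] by blast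
  then have "(\<lambda>x. (- 1 * f' x + 0) * (inverse (f x) * inverse (f x))) \<in> C_holder r a"
    by (intro C_holder_mult[OF a(2)] C_holder_affine[OF a(2) f'(2)])
  then show ?case
  proof (rule C_holder_SucI[rotated])
    fix x :: real assume x: "x \<in> unit_Icc"
    then have "f x \<noteq> 0" using Suc.prems(2) m(1) by force
    then show "((\<lambda>x. inverse (f x)) has_real_derivative
        (- 1 * f' x + 0) * (inverse (f x) * inverse (f x))) (at x within unit_Icc)"
      using f'(1)[OF x] by (auto intro!: derivative_eq_intros)
  qed
qed

section \<open>Inverse functions\<close>

text \<open>
  Unlike the inverse rules for open sets, this version covers one-sided derivatives at the
  endpoints of an interval.
\<close>

lemma has_real_derivative_inverse_within:
  fixes h g :: "real \<Rightarrow> real"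
  assumes "(h has_real_derivative d) (at (g y) within S)" "d \<noteq> 0"
    and "continuous (at y within T) g" "y \<in> T"
    and "\<And>z. z \<in> T \<Longrightarrow> g z \<in> S \<and> h (g z) = z"
  shows "(g has_real_derivative inverse d) (at y within T)"
proof -
  have hg: "h (g z) = z" if "z \<in> T" for z using assms(5) that by blast
  have "((\<lambda>x. (h x - h (g y)) / (x - g y)) \<longlongrightarrow> d) (at (g y) within S)"
    using assms(1) by (simp add: has_field_derivative_iff)
  moreover have "filterlim g (at (g y) within S) (at y within T)"
  proof (subst filterlim_at, intro conjI)
    show "\<forall>\<^sub>F z in at y within T. g z \<in> S \<and> g z \<noteq> g y"
      unfolding eventually_at_filter
      using assms(4,5) by (intro always_eventually) (metis hg)
    show "(g \<longlongrightarrow> g y) (at y within T)" using assms(3) by (simp add: continuous_within)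
  qed
  ultimately have "((\<lambda>z. (h (g z) - h (g y)) / (g z - g y)) \<longlongrightarrow> d) (at y within T)"
    by (rule filterlim_compose)
  then have "((\<lambda>z. inverse ((h (g z) - h (g y)) / (g z - g y))) \<longlongrightarrow> inverse d) (at y within T)"
    using assms(2) by (rule tendsto_inverse)
  moreover have "\<forall>\<^sub>F z in at y within T.
      inverse ((h (g z) - h (g y)) / (g z - g y)) = (g z - g y) / (z - y)"
    unfolding eventually_at_filter using hg assms(4) by (intro always_eventually) simp
  ultimately have "((\<lambda>z. (g z - g y) / (z - y)) \<longlongrightarrow> inverse d) (at y within T)"
    by (rule Lim_transform_eventually)
  then show ?thesis by (simp add: has_field_derivative_iff)
qed

lemma unit_deriv_lower_bound:
  fixes h :: "real \<Rightarrow> real"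
  assumes h': "\<And>x. x \<in> unit_Icc \<Longrightarrow> (h has_real_derivative h' x) (at x within unit_Icc)"
      "\<And>x. x \<in> unit_Icc \<Longrightarrow> m \<le> h' x"
    and xy: "x \<in> unit_Icc" "y \<in> unit_Icc" "x \<le> y"
  shows "m * (y - x) \<le> h y - h x"
proof -
  have "h x - m * x \<le> h y - m * y"
  proof (rule DERIV_nonneg_imp_increasing_open[OF xy(3)])
    show "\<exists>d. ((\<lambda>x. h x - m * x) has_real_derivative d) (at z) \<and> 0 \<le> d"
      if z: "x < z" "z < y" for z
    proof -
      have zI: "z \<in> unit_Icc" "z \<in> interior unit_Icc"
        using z xy by auto
      then have "(h has_real_derivative h' z) (at z)" "m \<le> h' z"
        using h'[OF zI(1)] unfolding at_within_interior[OF zI(2)] by auto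
      then show ?thesis
        by (intro exI[of _ "h' z - m"] conjI) (auto intro!: derivative_eq_intros)
    qed
    have "continuous_on unit_Icc h" by (rule DERIV_continuous_on[OF h'(1)])
    then show "continuous_on {x..y} (\<lambda>x. h x - m * x)"
      using continuous_on_subset[of unit_Icc h "{x..y}"] xy by (auto intro!: continuous_intros)
  qed
  then show ?thesis by (simp add: algebra_simps)
qed

text \<open>
  The regularity is bootstrapped from \<open>g' = 1 / (h' \<circ> g)\<close>: the right-hand side has order \<open>q\<close> as
  soon as \<open>g\<close> has order \<open>q\<close>.
\<close>

lemma C_holder_inverse_function:
  assumes a: "0 \<le> a" "a \<le> 1" and h: "h \<in> C_holder (Suc r) a"
    and m: "m > 0"
    and h': "\<And>x. x \<in> unit_Icc \<Longrightarrow> (h has_real_derivative h' x) (at x within unit_Icc) \<and> m \<le> h' x"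
    and g: "\<And>y. y \<in> unit_Icc \<Longrightarrow> g y \<in> unit_Icc \<and> h (g y) = y"
  shows "g \<in> C_holder (Suc r) a"
proof -
  have expand: "m * \<bar>x - y\<bar> \<le> \<bar>h x - h y\<bar>" if "x \<in> unit_Icc" "y \<in> unit_Icc" for x y
    using unit_deriv_lower_bound[of h h' m x y] unit_deriv_lower_bound[of h h' m y x] h' that
    by (cases "x \<le> y") auto
  have lip: "\<bar>g x - g y\<bar> \<le> (1 / m) * \<bar>x - y\<bar>" if "x \<in> unit_Icc" "y \<in> unit_Icc" for x y
    using expand[of "g x" "g y"] g that m by (simp add: field_simps)
  have cont: "continuous_on unit_Icc g"
    by (rule lipschitz_on_continuous_on[of "1 / m"])
       (use lip m in \<open>auto simp: lipschitz_on_def dist_real_def\<close>)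
  have deriv: "(g has_real_derivative inverse (h' (g y))) (at y within unit_Icc)"
    if "y \<in> unit_Icc" for y
  proof (rule has_real_derivative_inverse_within[where S = unit_Icc])
    show "(h has_real_derivative h' (g y)) (at (g y) within unit_Icc)" "h' (g y) \<noteq> 0"
      using h'[of "g y"] g that m by auto
    show "continuous (at y within unit_Icc) g"
      using cont that by (simp add: continuous_on_eq_continuous_within)
  qed (use g that in auto)
  have h'_in: "h' \<in> C_holder q b" if "h \<in> C_holder (Suc q) b" for q b
    using that C_holder_cong[of "deriv_unit h" h' q b] deriv_unit_eqI h' by (auto simp: C_holder_Suc)
  have g1: "g \<in> C_holder 1 0"
  proof -
    have "continuous_on unit_Icc h'" using h'_in[OF h] C_holder_continuous by blast
    then have "continuous_on unit_Icc (\<lambda>y. h' (g y))"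
      by (rule continuous_on_compose2[of unit_Icc h']) (use cont g in auto)
    then have "continuous_on unit_Icc (\<lambda>y. inverse (h' (g y)))"
      using h' g m by (intro continuous_on_inverse) force+
    then have "(\<lambda>y. inverse (h' (g y))) \<in> C_holder 0 0"
      by (simp flip: C_nat_eq_C_holder_0 add: C_nat_0)
    then show ?thesis using C_holder_SucI[of g "\<lambda>y. inverse (h' (g y))" 0 0] deriv by simp
  qed
  have "g \<in> C_holder q a" if "q \<le> Suc r" for q
    using that
  proof (induction q)
    case 0
    then show ?case using cont lip m a by (auto simp: C_holder_0 intro!: holder_on_Lipschitz[of g "1/m"])
  next
    case (Suc q)
    have "h' \<in> C_holder q a"
      using h'_in[OF h] Suc.prems C_holder_antimono[OF a(2)] by auto
    then have "(\<lambda>y. h' (g y)) \<in> C_holder q a"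
      by (rule C_holder_compose[OF a]) (use Suc g1 g in auto)
    then have "(\<lambda>y. inverse (h' (g y))) \<in> C_holder q a"
      by (rule C_holder_inverse[OF a _ m]) (use h' g in auto)
    then show ?case by (rule C_holder_SucI[rotated]) (rule deriv)
  qed
  then show ?thesis by blast
qed

section \<open>The classes with real or infinite exponent\<close>

lemma C_class_finite:
  assumes "0 < a" "a \<le> 1"
  shows "C_class (ereal (real (Suc r) + a)) = C_holder (Suc r) a"
proof -
  have "q = Suc r \<and> b = a" if "real (Suc r) + a = real q + b" "0 < b" "b \<le> 1" for q b
  proof -
    have "q = Suc r"
      using that assms by linarith
    then show ?thesis using that(1) by simp
  qed
  moreover have "ereal (real (Suc r) + a) \<noteq> 1" "ereal (real (Suc r) + a) \<noteq> \<infinity>"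
    using assms by (auto simp: one_ereal_def)
  ultimately have "f \<in> C_class (ereal (real (Suc r) + a)) \<longleftrightarrow> f \<in> C_holder (Suc r) a" for f
    using assms unfolding C_class_def mem_Collect_eq ereal.inject
    by (metis One_nat_def Suc_le_mono le0)
  then show ?thesis by blast
qed

lemma C_class_1: "C_class 1 = C_holder 1 0"
  by (simp add: C_class_def C_nat_eq_C_holder_0 one_ereal_def)

lemma C_class_infinity: "C_class \<infinity> = {f. \<forall>r. f \<in> C_holder (Suc r) 0}"
  unfolding C_class_def C_nat_eq_C_holder_0
  using C_holder_SucD[of 0] by auto

lemma exponent_cases:
  assumes "1 \<le> (s :: ereal)"
  obtains (infinite) "s = \<infinity>" | (one) "s = 1"
    | (finite) r a where "0 < a" "a \<le> 1" "s = ereal (real (Suc r) + a)"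
proof (cases s)
  case (real x)
  have "x \<ge> 1" using assms real by (simp add: one_ereal_def)
  show ?thesis
  proof (cases "x = 1")
    case False
    define r where "r = nat (\<lceil>x\<rceil> - 2)"
    have "\<lceil>x\<rceil> \<ge> 2" using \<open>x \<ge> 1\<close> False by linarith
    then have "real (Suc r) = of_int \<lceil>x\<rceil> - 1" by (simp add: r_def)
    then show ?thesis
      using real finite[of "x - real (Suc r)" r] ceiling_correct[of x] by auto
  qed (use real one in \<open>simp add: one_ereal_def\<close>)
qed (use assms infinite in auto)

text \<open>
  For all exponents the class is an intersection of Hoelder classes of positive order with
  exponents in \<open>{0..1}\<close>, so that closure properties carry over.
\<close>

lemma C_class_eq_Inter_C_holder:
  assumes "1 \<le> s"
  obtains P where "P \<noteq> {}" "\<And>r a. (r, a) \<in> P \<Longrightarrow> 0 \<le> a \<and> a \<le> 1"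
    "C_class s = {f. \<forall>(r, a)\<in>P. f \<in> C_holder (Suc r) a}"
  using assms
proof (cases rule: exponent_cases)
  case infinite
  then show ?thesis using that[of "UNIV \<times> {0}"] by (auto simp: C_class_infinity)
next
  case one
  then show ?thesis using that[of "{(0, 0)}"] by (auto simp: C_class_1)
next
  case (finite r a)
  then show ?thesis using that[of "{(r, a)}"] C_class_finite[of a r] by simp
qed

lemma C_class_cong:
  assumes "1 \<le> s" "\<And>x. x \<in> unit_Icc \<Longrightarrow> f x = g x"
  shows "f \<in> C_class s \<longleftrightarrow> g \<in> C_class s"
proof -
  obtain P where P: "P \<noteq> {}" "\<And>r a. (r, a) \<in> P \<Longrightarrow> 0 \<le> a \<and> a \<le> 1"
    "C_class s = {f. \<forall>(r, a)\<in>P. f \<in> C_holder (Suc r) a}"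
    by (rule C_class_eq_Inter_C_holder[OF assms(1)]) (rule that)
  have "f \<in> C_holder (Suc r) a \<longleftrightarrow> g \<in> C_holder (Suc r) a" for r a
    by (rule C_holder_cong[OF assms(2)])
  then show ?thesis unfolding P(3) by (simp add: split_beta)
qed

lemma C_class_ident: "1 \<le> s \<Longrightarrow> (\<lambda>x. x) \<in> C_class s"
  by (elim C_class_eq_Inter_C_holder) (auto intro: C_holder_ident)

lemma C_class_affine:
  assumes "1 \<le> s" "f \<in> C_class s"
  shows "(\<lambda>x. m * f x + b) \<in> C_class s"
  using assms by (elim C_class_eq_Inter_C_holder) (auto intro!: C_holder_affine)

lemma C_class_add:
  assumes "1 \<le> s" "f \<in> C_class s" "g \<in> C_class s"
  shows "(\<lambda>x. f x + g x) \<in> C_class s"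
  using assms by (elim C_class_eq_Inter_C_holder) (auto intro!: C_holder_add)

lemma C_class_imp_C1:
  assumes "1 \<le> s" "f \<in> C_class s"
  shows "f \<in> C_holder 1 0"
proof -
  obtain P where P: "P \<noteq> {}" "\<And>r a. (r, a) \<in> P \<Longrightarrow> 0 \<le> a \<and> a \<le> 1"
    "C_class s = {f. \<forall>(r, a)\<in>P. f \<in> C_holder (Suc r) a}"
    by (rule C_class_eq_Inter_C_holder[OF assms(1)]) (rule that)
  obtain r a where "(r, a) \<in> P" using P(1) by auto
  then have "f \<in> C_holder (Suc r) a" using P(3) assms(2) by auto
  then have "f \<in> C_holder (Suc r) 0"
    by (simp add: C_holder_def[of _ a] flip: C_nat_eq_C_holder_0)
  then show ?thesis using C_holder_antimono[of 0 1 "Suc r" f] by simp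
qed

lemma C_class_differentiable:
  assumes "1 \<le> s" "f \<in> C_class s"
  shows "f differentiable_on unit_Icc"
  using C_class_imp_C1[OF assms] by (simp add: C_holder_Suc)

lemma C_class_inverse_function:
  assumes "1 \<le> s" "h \<in> C_class s" "m > 0"
    and "\<And>x. x \<in> unit_Icc \<Longrightarrow> (h has_real_derivative h' x) (at x within unit_Icc) \<and> m \<le> h' x"
    and "\<And>y. y \<in> unit_Icc \<Longrightarrow> g y \<in> unit_Icc \<and> h (g y) = y"
  shows "g \<in> C_class s"
proof -
  obtain P where P: "P \<noteq> {}" "\<And>r a. (r, a) \<in> P \<Longrightarrow> 0 \<le> a \<and> a \<le> 1"
    "C_class s = {f. \<forall>(r, a)\<in>P. f \<in> C_holder (Suc r) a}"
    by (rule C_class_eq_Inter_C_holder[OF assms(1)]) (rule that)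
  have "g \<in> C_holder (Suc r) a" if ra: "(r, a) \<in> P" for r a
    by (rule C_holder_inverse_function[where h = h and h' = h' and m = m])
       (use P assms(2-5) ra in auto)
  then show ?thesis using P by auto
qed

text \<open>
  The criterion for failure of higher regularity: at \<open>p\<close> the derivative of order \<open>r\<close>
  vanishes on the left and equals a modulus \<open>w\<close> on the right that dominates both the identity
  and all powers with exponent above \<open>a\<close>. The first property excludes a derivative
  of order \<open>r + 1\<close>, the second a better Hoelder exponent.
\<close>

lemma not_C_class_above:
  fixes w :: "real \<Rightarrow> real"
  assumes a: "0 \<le> a" and r: "1 \<le> r" and p: "0 < p" and d: "0 < d" "p + d \<le> 1"
    and left: "\<And>x. 0 \<le> x \<Longrightarrow> x \<le> p \<Longrightarrow> (deriv_unit ^^ r) v x = 0"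
    and right: "\<And>x. p \<le> x \<Longrightarrow> x \<le> p + d \<Longrightarrow> (deriv_unit ^^ r) v x = w (x - p)"
    and lin: "\<forall>\<^sub>F t in at_right 0. t \<le> w t"
    and pow: "\<And>b. a < b \<Longrightarrow> filterlim (\<lambda>t. w t / t powr b) at_top (at_right 0)"
    and t: "ereal (real r + a) < t"
  shows "v \<notin> C_class t"
proof
  assume v: "v \<in> C_class t"
  let ?D = "(deriv_unit ^^ r) v"
  have pI: "p \<in> unit_Icc" using p d by auto
  have small: "\<forall>\<^sub>F t in at_right 0. 0 < t \<and> t \<le> d"
    unfolding eventually_at_right[OF d(1)] using d(1) by auto
  have noC: "v \<notin> C_nat (Suc r)"
  proof
    assume "v \<in> C_nat (Suc r)"
    then have "?D differentiable_on unit_Icc" by (auto simp: C_nat_def)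
    then obtain l where l: "(?D has_real_derivative l) (at p within unit_Icc)"
      using differentiable_on_deriv_unit[OF _ pI] by blast
    have l1: "((\<lambda>x. (?D x - ?D p) / (x - p)) \<longlongrightarrow> l) (at p within {0..p})"
      using l d pI unfolding has_field_derivative_iff
      by (rule_tac tendsto_within_subset[of _ _ _ unit_Icc]) auto
    have "((\<lambda>x. (?D x - ?D p) / (x - p)) \<longlongrightarrow> 0) (at p within {0..p})"
      by (rule tendsto_eventually) (use left p in \<open>auto simp: eventually_at_filter\<close>)
    moreover have "at p within {0..p} \<noteq> bot"
      using p by (simp add: trivial_limit_within islimpt_Icc)
    ultimately have "l = 0" using l1 tendsto_unique by blast
    have "((\<lambda>x. (?D x - ?D p) / (x - p)) \<longlongrightarrow> l) (at_right p)"
    proof -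
      have "at_right p = at p within {p..1}"
        using at_within_Icc_at_right[of p 1] d by auto
      then show ?thesis
        using l pI unfolding has_field_derivative_iff
        by (simp, rule_tac tendsto_within_subset[of _ _ _ unit_Icc]) auto
    qed
    then have lim: "((\<lambda>t. (?D (t + p) - ?D p) / t) \<longlongrightarrow> l) (at_right 0)"
      unfolding filterlim_at_right_to_0[of _ _ p] by simp
    have "\<forall>\<^sub>F t in at_right 0. 1 \<le> (?D (t + p) - ?D p) / t"
      using small lin
    proof eventually_elim
      case (elim t)
      have "?D (t + p) = w t" "?D p = 0" using elim right[of "t + p"] left[of p] p by auto
      then show ?case using elim by (simp add: divide_simps)
    qed
    from tendsto_lowerbound[OF lim this] have "1 \<le> l" by simp
    then show False using \<open>l = 0\<close> by simp
  qed
  have noH: "\<not> holder_on b unit_Icc ?D" if b: "a < b" for b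
  proof
    assume "holder_on b unit_Icc ?D"
    then obtain C where C: "\<And>x y. x \<in> unit_Icc \<Longrightarrow> y \<in> unit_Icc \<Longrightarrow>
        \<bar>?D x - ?D y\<bar> \<le> C * \<bar>x - y\<bar> powr b" by (rule holder_onE) blast
    have "\<forall>\<^sub>F t in at_right 0. C < w t / t powr b"
      using pow[OF b] by (simp add: filterlim_at_top_dense)
    then have "\<forall>\<^sub>F t in at_right (0::real). False"
      using small
    proof eventually_elim
      case (elim t)
      have "\<bar>?D (p + t) - ?D p\<bar> \<le> C * \<bar>(p + t) - p\<bar> powr b"
        using elim p d by (intro C) auto
      then have "\<bar>w t\<bar> \<le> C * t powr b"
        using elim right[of "p + t"] left[of p] p by auto
      then show False using elim by (simp add: field_simps)
    qed
    then show False by (simp add: eventually_False)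
  qed
  have "1 \<le> t"
    using t r a by (cases t) (auto simp: one_ereal_def)
  then show False
  proof (cases rule: exponent_cases)
    case infinite
    then show False using v noC by (simp add: C_class_infinity C_nat_eq_C_holder_0)
  next
    case one
    then show False using t r a by (simp add: one_ereal_def)
  next
    case (finite q b)
    then have vq: "v \<in> C_holder (Suc q) b" using v C_class_finite[of b q] by simp
    consider "Suc q < r" | "Suc q = r" | "Suc r \<le> Suc q" by linarith
    then show False
    proof cases
      case 1
      then show False using t finite a by auto
    next
      case 2
      then show False using vq noH[of b] t finite by (auto simp: C_holder_def)
    next
      case 3
      have "v \<in> C_nat (Suc q)" using vq by (simp add: C_holder_def)
      then have "v \<in> C_holder (Suc q) 0" by (simp add: C_nat_eq_C_holder_0)
      then have "v \<in> C_holder (Suc r) 0" using C_holder_antimono[OF _ 3] by simp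
      then show False using noC by (simp add: C_nat_eq_C_holder_0)
    qed
  qed
qed

section \<open>Bumps of prescribed finite regularity\<close>

text \<open>
  A sequence of successive derivatives computes the iterated operator \<open>deriv_unit\<close>.
\<close>

lemma C_holder_derivative_chain:
  assumes "\<And>k x. k < r \<Longrightarrow> x \<in> unit_Icc \<Longrightarrow>
      (D k has_real_derivative D (Suc k) x) (at x within unit_Icc)"
    and "D r \<in> C_holder 0 a"
  shows "D 0 \<in> C_holder r a"
    and "k \<le> r \<Longrightarrow> x \<in> unit_Icc \<Longrightarrow> (deriv_unit ^^ k) (D 0) x = D k x"
proof -
  have "q \<le> r \<Longrightarrow> D (r - q) \<in> C_holder q a" for q
  proof (induction q)
    case (Suc q)
    then have "D (r - q) \<in> C_holder q a" "r - q = Suc (r - Suc q)" by auto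
    then show ?case
      using Suc.prems assms(1)[of "r - Suc q"] by (intro C_holder_SucI[of _ "D (r - q)"]) auto
  qed (use assms(2) in simp)
  from this[of r] show "D 0 \<in> C_holder r a" by simp
  show "k \<le> r \<Longrightarrow> x \<in> unit_Icc \<Longrightarrow> (deriv_unit ^^ k) (D 0) x = D k x"
  proof (induction k arbitrary: x)
    case (Suc k)
    have "deriv_unit ((deriv_unit ^^ k) (D 0)) x = deriv_unit (D k) x"
      by (rule deriv_unit_cong) (use Suc in auto)
    also have "\<dots> = D (Suc k) x" using Suc.prems assms(1) by (intro deriv_unit_eqI) auto
    finally show ?case by simp
  qed simp
qed

text \<open>
  \<open>D 0, ..., D r\<close> are successive derivatives on the whole line of a bump that vanishes outside
  \<open>{p<..<q}\<close>; the last one is continuous, satisfies a Hoelder condition with exponent \<open>a\<close>, and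
  has the germ \<open>w (x - p)\<close> on the right of \<open>p\<close>. The members of the sequence beyond \<open>D r\<close> are
  irrelevant.
\<close>

definition bump_chain :: "nat \<Rightarrow> real \<Rightarrow> (real \<Rightarrow> real) \<Rightarrow> real \<Rightarrow> real \<Rightarrow> (nat \<Rightarrow> real \<Rightarrow> real) \<Rightarrow> bool"
  where "bump_chain r a w p q D \<longleftrightarrow>
    (\<forall>k<r. \<forall>x. (D k has_real_derivative D (Suc k) x) (at x)) \<and>
    (\<forall>k\<le>r. \<forall>x. x \<notin> {p<..<q} \<longrightarrow> D k x = 0) \<and>
    continuous_on UNIV (D r) \<and> holder_on a UNIV (D r) \<and>
    (\<exists>d>0. \<forall>x\<in>{p..p + d}. D r x = w (x - p))"

lemma ex_antiderivative:
  fixes f :: "real \<Rightarrow> real"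
  assumes cont: "continuous_on UNIV f" and zero: "\<And>x. x \<le> p \<Longrightarrow> f x = 0"
  obtains F where "\<And>x. (F has_real_derivative f x) (at x)"
proof
  fix x
  let ?F = "\<lambda>x. integral {p - 1..x} f"
  show "(?F has_real_derivative f x) (at x)"
  proof (cases "x < p")
    case True
    have F0: "?F y = 0" if "y < p" for y
      using integral_cong[of "{p - 1..y}" f "\<lambda>_. 0"] zero that by simp
    have "((\<lambda>_. 0) has_real_derivative f x) (at x)" using zero True by simp
    then show ?thesis
      by (rule has_field_derivative_transform_within_open[of _ _ _ "{..<p}"]) (use True F0 in auto)
  next
    case False
    have "(?F has_real_derivative f x) (at x within {p - 1..x + 1})"
      using continuous_on_subset[OF cont, of "{p - 1..x + 1}"] False
      by (intro integral_has_real_derivative) auto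
    then show ?thesis using False at_within_interior[of x "{p - 1..x + 1}"] by simp
  qed
qed

lemma has_zero_derivative_imp_eq:
  fixes F :: "real \<Rightarrow> real"
  assumes "\<And>x. (F has_real_derivative f x) (at x)" "convex S" "\<And>x. x \<in> S \<Longrightarrow> f x = 0"
    and "x \<in> S" "y \<in> S"
  shows "F x = F y"
  using has_field_derivative_zero_constant[OF assms(2), of F] assms(1,3-5)
    has_field_derivative_at_within by metis

text \<open>
  In the induction step a chain supported in the left half of the interval is replaced by its
  difference with its translate into the right half. The difference has integral zero, so that its
  antiderivative is again a bump.
\<close>

lemma ex_bump_chain:
  assumes a: "0 \<le> a"
    and w: "w 0 = 0" "continuous_on {0..1/2} w" "holder_on a {0..1/2} w"
    and "p < q" "q - p \<le> 1"
  shows "\<exists>D. bump_chain r a w p q D"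
  using assms(5,6)
proof (induction r arbitrary: q)
  case 0
  \<comment> \<open>the tent function over the interval, which is 1-Lipschitz with values in the domain of \<open>w\<close>\<close>
  define T where "T = (\<lambda>x. max 0 (min (x - p) (q - x)))"
  have T: "T x \<in> {0..1/2}" "\<bar>T x - T y\<bar> \<le> \<bar>x - y\<bar>" for x y
    using 0 by (auto simp: T_def max_def min_def)
  obtain C where C: "C \<ge> 0" "\<And>x y. x \<in> {0..1/2} \<Longrightarrow> y \<in> {0..1/2} \<Longrightarrow>
      \<bar>w x - w y\<bar> \<le> C * \<bar>x - y\<bar> powr a"
    using w(3) by (rule holder_onE) blast
  have "\<bar>w (T x) - w (T y)\<bar> \<le> C * \<bar>x - y\<bar> powr a" for x y
  proof -
    have "\<bar>w (T x) - w (T y)\<bar> \<le> C * \<bar>T x - T y\<bar> powr a" using C(2) T(1) by blast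
    also have "\<dots> \<le> C * \<bar>x - y\<bar> powr a"
      using C(1) a T(2) by (intro mult_left_mono powr_mono2) auto
    finally show ?thesis .
  qed
  then have hol: "holder_on a UNIV (\<lambda>x. w (T x))" unfolding holder_on_def by blast
  have "continuous_on UNIV T" unfolding T_def by (intro continuous_intros)
  then have cont: "continuous_on UNIV (\<lambda>x. w (T x))"
    by (rule continuous_on_compose2[OF w(2)]) (use T in auto)
  have "T x = 0" if "x \<notin> {p<..<q}" for x
    using that by (auto simp: T_def max_def min_def)
  moreover have "T x = x - p" if "x \<in> {p..p + (q - p) / 2}" for x
    using that by (auto simp: T_def max_def min_def field_simps)
  moreover have "(q - p) / 2 > 0" using 0 by simp
  ultimately have "\<exists>d>0. \<forall>x\<in>{p..p + d}. w (T x) = w (x - p)"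
    "\<forall>x. x \<notin> {p<..<q} \<longrightarrow> w (T x) = 0"
    using w(1) by metis+
  then show ?case
    using hol cont by (intro exI[of _ "\<lambda>_ x. w (T x)"]) (simp add: bump_chain_def)
next
  case (Suc r)
  define e where "e = (q - p) / 2"
  have e: "e > 0" "p < p + e" "p + e - p \<le> 1" "q = p + e + e" using Suc.prems by (auto simp: e_def)
  obtain D where "bump_chain r a w p (p + e) D" using Suc.IH[OF e(2,3)] by blast
  then have D: "\<And>k x. k < r \<Longrightarrow> (D k has_real_derivative D (Suc k) x) (at x)"
    and supp: "\<And>k x. k \<le> r \<Longrightarrow> x \<notin> {p<..<p + e} \<Longrightarrow> D k x = 0"
    and cont: "continuous_on UNIV (D r)" and hol: "holder_on a UNIV (D r)"
    and ex_d: "\<exists>d>0. \<forall>x\<in>{p..p + d}. D r x = w (x - p)"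
    unfolding bump_chain_def by auto
  have "continuous_on UNIV (D 0)"
  proof (cases "r = 0")
    case False
    then show ?thesis using D[of 0] by (auto intro: continuous_at_imp_continuous_on DERIV_isCont)
  qed (use cont in simp)
  then obtain F where F: "\<And>x. (F has_real_derivative D 0 x) (at x)"
    using supp[of 0] ex_antiderivative[of "D 0" p] by auto
  have F_left: "F x = F y" if "x \<le> p" "y \<le> p" for x y
    by (rule has_zero_derivative_imp_eq[OF F, of "{..p}"]) (use supp[of 0] that in auto)
  have F_right: "F x = F y" if "x \<ge> p + e" "y \<ge> p + e" for x y
    by (rule has_zero_derivative_imp_eq[OF F, of "{p + e..}"]) (use supp[of 0] that in auto)
  define E where "E = (\<lambda>k x. case k of 0 \<Rightarrow> F x - F (x - e) | Suc j \<Rightarrow> D j x - D j (x - e))"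
  have E: "E 0 = (\<lambda>x. F x - F (x - e))" "E (Suc j) = (\<lambda>x. D j x - D j (x - e))" for j
    by (simp_all add: E_def)
  have shift: "((\<lambda>x. g x - g (x - e)) has_real_derivative g' x - g' (x - e)) (at x)"
    if "\<And>x. (g has_real_derivative g' x) (at x)" for g g' x
  proof -
    have "((\<lambda>x. g (x - e)) has_real_derivative g' (x - e) * 1) (at x)"
      by (rule DERIV_chain2[OF that]) (auto intro!: derivative_eq_intros)
    then show ?thesis using that by (auto intro!: derivative_eq_intros)
  qed
  have "(E k has_real_derivative E (Suc k) x) (at x)" if "k < Suc r" for k x
    using that by (cases k) (auto simp: E intro!: shift F D)
  moreover have "E k x = 0" if "k \<le> Suc r" "x \<notin> {p<..<q}" for k x
  proof (cases k)
    case 0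
    show ?thesis
      using F_left[of x "x - e"] F_right[of x "x - e"] that e 0 by (force simp: E)
  next
    case (Suc j)
    then show ?thesis using supp[of j x] supp[of j "x - e"] that e by (auto simp: E)
  qed
  moreover have "continuous_on UNIV (E (Suc r))"
    unfolding E by (intro continuous_intros continuous_on_compose2[OF cont]) auto
  moreover have "holder_on a UNIV (E (Suc r))"
  proof -
    obtain C where C: "C \<ge> 0" "\<And>x y. \<bar>D r x - D r y\<bar> \<le> C * \<bar>x - y\<bar> powr a"
      using hol by (rule holder_onE) simp
    have "\<bar>E (Suc r) x - E (Suc r) y\<bar> \<le> (2 * C) * \<bar>x - y\<bar> powr a" for x y
      using C(2)[of x y] C(2)[of "x - e" "y - e"] unfolding E by simp
    then show ?thesis unfolding holder_on_def by blast
  qed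
  moreover have "\<exists>d>0. \<forall>x\<in>{p..p + d}. E (Suc r) x = w (x - p)"
  proof -
    obtain d where "d > 0" "\<And>x. x \<in> {p..p + d} \<Longrightarrow> D r x = w (x - p)" using ex_d by auto
    moreover have "D r (x - e) = 0" if "x \<le> p + e" for x using supp[of r "x - e"] that by simp
    ultimately show ?thesis
      using e by (intro exI[of _ "min d e"]) (auto simp: E)
  qed
  ultimately show ?case by (intro exI[of _ E]) (simp add: bump_chain_def)
qed

lemma powr_holder:
  assumes "0 < a" "a \<le> 1"
  shows "holder_on a {0..} (\<lambda>t. t powr a)"
proof -
  \<comment> \<open>subadditivity of the power: by homogeneity it suffices that \<open>t \<le> t powr a\<close> on \<open>{0..1}\<close>\<close>
  have *: "\<bar>x powr a - y powr a\<bar> \<le> \<bar>x - y\<bar> powr a" if "0 \<le> y" "y \<le> x" for x y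
  proof (cases "x = 0")
    case False
    then have x: "x > 0" using that by simp
    have "1 = (1 - y / x) powr 1 + (y / x) powr 1"
      using that x by (simp add: field_simps)
    also have "\<dots> \<le> (1 - y / x) powr a + (y / x) powr a"
      using that x assms by (intro add_mono powr_mono') (auto simp: field_simps)
    finally have "x powr a * 1 \<le> x powr a * ((1 - y / x) powr a + (y / x) powr a)"
      by (intro mult_left_mono) auto
    also have "\<dots> = (x * (1 - y / x)) powr a + (x * (y / x)) powr a"
      using that x powr_mult[of x "1 - y / x" a] powr_mult[of x "y / x" a]
      by (simp add: distrib_left del: mult_eq_0_iff)
    also have "x * (1 - y / x) = x - y" using x by (simp add: field_simps)
    finally have "x powr a \<le> (x - y) powr a + y powr a" using x by (simp add: algebra_simps)
    moreover have "y powr a \<le> x powr a" using that assms by (intro powr_mono2) auto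
    ultimately show ?thesis using that by simp
  qed (use that in simp)
  have "\<bar>x powr a - y powr a\<bar> \<le> 1 * \<bar>x - y\<bar> powr a" if "0 \<le> x" "0 \<le> y" for x y
    using *[of x y] *[of y x] that by (cases "x \<le> y") (auto simp: abs_minus_commute)
  then show ?thesis unfolding holder_on_def by (metis atLeast_iff)
qed

text \<open>
  A modulus of continuity that is exactly \<open>a\<close>-Hoelder at \<open>0\<close>; for \<open>a = 0\<close> it is continuous but not
  Hoelder with any positive exponent.
\<close>

lemma ex_modulus:
  assumes "0 \<le> a" "a \<le> 1"
  obtains w :: "real \<Rightarrow> real" where "w 0 = 0" "continuous_on {0..1/2} w" "holder_on a {0..1/2} w"
    "\<forall>\<^sub>F t in at_right 0. t \<le> w t"
    "\<And>b. a < b \<Longrightarrow> filterlim (\<lambda>t. w t / t powr b) at_top (at_right 0)"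
proof (cases "a = 0")
  case True
  \<comment> \<open>the value at \<open>0\<close> is \<open>0\<close> because \<open>ln 0 = 0\<close> and \<open>inverse 0 = 0\<close>\<close>
  define w where "w = (\<lambda>t :: real. - inverse (ln t))"
  have w_lim: "(w \<longlongrightarrow> 0) (at_right 0)" unfolding w_def by real_asymp
  have w_cont: "isCont w t" if "0 < t" "t \<le> 1/2" for t
    unfolding w_def using that by (intro continuous_intros) auto
  have w0: "w 0 = 0" by (simp add: w_def)
  have "continuous (at t within {0..1/2}) w" if "t \<in> {0..1/2}" for t
  proof (cases "t = 0")
    case True
    then show ?thesis
      using w_lim w0
      by (simp add: continuous_within at_within_Icc_at_right)
  next
    case False
    then show ?thesis using that w_cont by (auto intro: continuous_at_imp_continuous_at_within)
  qed
  then have cont: "continuous_on {0..1/2} w" by (simp add: continuous_on_eq_continuous_within)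
  then have "bounded (w ` {0..1/2})" by (intro compact_imp_bounded compact_continuous_image) auto
  then obtain B where B: "\<And>x. x \<in> {0..1/2} \<Longrightarrow> \<bar>w x\<bar> \<le> B" unfolding bounded_iff by force
  have "\<bar>w x - w y\<bar> \<le> (2 * B) * \<bar>x - y\<bar> powr 0" if "x \<in> {0..1/2}" "y \<in> {0..1/2}" for x y
    using B[OF that(1)] B[OF that(2)] by (cases "x = y") auto
  then have "holder_on 0 {0..1/2} w" unfolding holder_on_def by blast
  moreover have "\<forall>\<^sub>F t in at_right 0. t \<le> w t" unfolding w_def by real_asymp
  moreover have "filterlim (\<lambda>t. w t / t powr b) at_top (at_right 0)" if "0 < b" for b
    unfolding w_def using that by real_asymp
  ultimately show ?thesis using that w0 cont True by simp
next
  case False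
  show ?thesis
  proof (rule that[of "\<lambda>t. t powr a"])
    show "continuous_on {0..1/2} (\<lambda>t :: real. t powr a)"
      using assms False by (intro continuous_intros continuous_on_powr') auto
    show "holder_on a {0..1/2} (\<lambda>t. t powr a)"
    proof -
      obtain C where "\<And>x y. x \<in> {0..} \<Longrightarrow> y \<in> {0..} \<Longrightarrow> \<bar>x powr a - y powr a\<bar> \<le> C * \<bar>x - y\<bar> powr a"
        using powr_holder[of a] assms False by (auto elim!: holder_onE)
      then show ?thesis unfolding holder_on_def by (intro exI[of _ C]) auto
    qed
    show "\<forall>\<^sub>F t in at_right 0. t \<le> t powr a"
      unfolding eventually_at_right_field
    proof (intro exI[of _ 1] conjI allI impI)
      fix t :: real assume "0 < t" "t < 1"
      then show "t \<le> t powr a" using powr_mono'[of a 1 t] assms by simp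
    qed simp
    show "filterlim (\<lambda>t. t powr a / t powr b) at_top (at_right 0)" if "a < b" for b
      using that by real_asymp
  qed simp
qed

lemma ex_bump_finite:
  assumes s: "1 \<le> s" "s \<noteq> \<infinity>" and pq: "0 < p" "p < q" "q < 1"
  obtains v where "v \<in> C_class s"
    and "\<And>x. x \<in> unit_Icc \<Longrightarrow> x \<notin> {p<..<q} \<Longrightarrow> v x = 0 \<and> deriv_unit v x = 0"
    and "\<And>t. s < t \<Longrightarrow> v \<notin> C_class t"
proof -
  obtain r a where ra: "0 \<le> a" "a \<le> 1" "s = ereal (real (Suc r) + a)"
    and C: "C_class s = C_holder (Suc r) a"
    using s(1)
  proof (cases rule: exponent_cases)
    case one
    show ?thesis by (rule that[of 0 0]) (use one C_class_1 in \<open>auto simp: one_ereal_def\<close>)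
  next
    case (finite r a)
    show ?thesis by (rule that[of a r]) (use finite C_class_finite[of a r] in auto)
  qed (use s in simp)
  obtain w :: "real \<Rightarrow> real" where w: "w 0 = 0" "continuous_on {0..1/2} w" "holder_on a {0..1/2} w"
    "\<forall>\<^sub>F t in at_right 0. t \<le> w t"
    "\<And>b. a < b \<Longrightarrow> filterlim (\<lambda>t. w t / t powr b) at_top (at_right 0)"
    using ex_modulus[OF ra(1,2)] by blast
  obtain D where "bump_chain (Suc r) a w p q D"
    using ex_bump_chain[OF ra(1) w(1-3)] pq by fastforce
  then have D: "\<And>k x. k < Suc r \<Longrightarrow> (D k has_real_derivative D (Suc k) x) (at x)"
    and supp: "\<And>k x. k \<le> Suc r \<Longrightarrow> x \<notin> {p<..<q} \<Longrightarrow> D k x = 0"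
    and cont: "continuous_on UNIV (D (Suc r))" and hol: "holder_on a UNIV (D (Suc r))"
    and ex_d: "\<exists>d>0. \<forall>x\<in>{p..p + d}. D (Suc r) x = w (x - p)"
    unfolding bump_chain_def by auto
  have D_within: "\<And>k x. k < Suc r \<Longrightarrow> x \<in> unit_Icc \<Longrightarrow>
      (D k has_real_derivative D (Suc k) x) (at x within unit_Icc)"
    using D has_field_derivative_at_within by blast
  have DI: "D (Suc r) \<in> C_holder 0 a"
    using cont hol by (auto simp: C_holder_0 holder_on_def intro: continuous_on_subset)
  note chain = C_holder_derivative_chain[of "Suc r" D a, OF D_within DI]
  obtain d where d: "d > 0" "\<And>x. x \<in> {p..p + d} \<Longrightarrow> D (Suc r) x = w (x - p)" using ex_d by auto
  show ?thesis
  proof (rule that[of "D 0"])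
    show "D 0 \<in> C_class s" using chain(1) C by simp
    show "D 0 x = 0 \<and> deriv_unit (D 0) x = 0" if "x \<in> unit_Icc" "x \<notin> {p<..<q}" for x
      using supp[of 0 x] supp[of 1 x] chain(2)[of 1 x] that by simp
    show "D 0 \<notin> C_class t" if "s < t" for t
    proof (rule not_C_class_above[where r = "Suc r" and p = p and d = "min d (q - p)" and w = w])
      show "(deriv_unit ^^ Suc r) (D 0) x = 0" if "0 \<le> x" "x \<le> p" for x
        using chain(2)[of "Suc r" x] supp[of "Suc r" x] that pq by simp
      show "(deriv_unit ^^ Suc r) (D 0) x = w (x - p)" if "p \<le> x" "x \<le> p + min d (q - p)" for x
        using chain(2)[of "Suc r" x] d(2)[of x] that pq by simp
    qed (use w ra d(1) pq \<open>s < t\<close> in auto)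
  qed
qed

section \<open>Smooth bumps and analyticity\<close>

text \<open>
  The functions \<open>(1 / t) ^ k * exp (- (1 / t))\<close>, extended by \<open>0\<close> to \<open>t \<le> 0\<close>. Their linear span is
  closed under differentiation, and \<open>flat_exp 0\<close> is the standard smooth function that is not analytic
  at \<open>0\<close>.
\<close>

definition flat_exp :: "nat \<Rightarrow> real \<Rightarrow> real" where
  "flat_exp k t = (if t \<le> 0 then 0 else (1 / t) ^ k * exp (- (1 / t)))"

lemma flat_exp_tendsto_0: "(flat_exp k \<longlongrightarrow> 0) (at_right 0)"
proof -
  have "((\<lambda>x. x ^ k / exp x) \<longlongrightarrow> (0 :: real)) at_top" by (rule tendsto_power_div_exp_0)
  then have "((\<lambda>t. (1 / t) ^ k / exp (1 / t)) \<longlongrightarrow> (0 :: real)) (at_right 0)"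
    by (rule filterlim_compose) (use filterlim_inverse_at_top_right in \<open>simp add: inverse_eq_divide\<close>)
  moreover have "\<forall>\<^sub>F t :: real in at_right 0. (1 / t) ^ k / exp (1 / t) = flat_exp k t"
    unfolding eventually_at_filter
    by (intro always_eventually) (auto simp: flat_exp_def exp_minus divide_inverse)
  ultimately show ?thesis by (rule Lim_transform_eventually)
qed

lemma flat_exp_deriv:
  "(flat_exp k has_real_derivative flat_exp (k + 2) t - real k * flat_exp (k + 1) t) (at t)"
proof -
  consider "t < 0" | "t = 0" | "t > 0" by linarith
  then show ?thesis
  proof cases
    case 1
    have "((\<lambda>_. 0) has_real_derivative 0) (at t)" by simp
    then have "(flat_exp k has_real_derivative 0) (at t)"
      by (rule has_field_derivative_transform_within_open[of _ _ _ "{..<0}"])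
        (use 1 in \<open>auto simp: flat_exp_def\<close>)
    then show ?thesis using 1 by (simp add: flat_exp_def)
  next
    case 2
    have "((\<lambda>h. (flat_exp k h - flat_exp k 0) / (h - 0)) \<longlongrightarrow> 0) (at_left 0)"
      by (rule tendsto_eventually) (simp add: eventually_at_filter flat_exp_def)
    moreover have "((\<lambda>h. (flat_exp k h - flat_exp k 0) / (h - 0)) \<longlongrightarrow> 0) (at_right 0)"
      \<comment> \<open>dividing by the argument raises the index by one\<close>
      by (rule Lim_transform_eventually[OF flat_exp_tendsto_0[of "Suc k"]])
        (auto simp: eventually_at_filter flat_exp_def intro!: always_eventually)
    ultimately have "(flat_exp k has_real_derivative 0) (at 0)"
      unfolding has_field_derivative_iff by (simp add: filterlim_at_split)
    then show ?thesis using 2 by (simp add: flat_exp_def)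
  next
    case 3
    have "((\<lambda>t. (1 / t) ^ k * exp (- (1 / t))) has_real_derivative
        (1 / t) ^ (k + 2) * exp (- (1 / t)) - real k * ((1 / t) ^ (k + 1) * exp (- (1 / t)))) (at t)"
    proof (cases k)
      case 0
      then show ?thesis
        using 3 by (auto intro!: derivative_eq_intros simp: field_simps power2_eq_square)
    next
      case (Suc n)
      have "((\<lambda>t. 1 / t) has_real_derivative - ((1 / t) ^ 2)) (at t)"
        using 3 by (auto intro!: derivative_eq_intros simp: power2_eq_square)
      from DERIV_mult[OF DERIV_power_Suc[OF this, of n] DERIV_exp[THEN DERIV_chain2, OF DERIV_minus[OF this]]]
      show ?thesis unfolding Suc by (rule DERIV_cong) (simp add: algebra_simps power2_eq_square)
    qed
    then have "(flat_exp k has_real_derivative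
        (1 / t) ^ (k + 2) * exp (- (1 / t)) - real k * ((1 / t) ^ (k + 1) * exp (- (1 / t)))) (at t)"
      by (rule has_field_derivative_transform_within_open[of _ _ _ "{0<..}"])
        (use 3 in \<open>auto simp: flat_exp_def\<close>)
    then show ?thesis using 3 by (simp add: flat_exp_def)
  qed
qed

lemma flat_exp_quadratic_smooth: "(\<lambda>x. flat_exp k ((x - p) * (q - x))) \<in> C_holder r 0"
proof (induction r arbitrary: k)
  have deriv: "((\<lambda>x. flat_exp k ((x - p) * (q - x))) has_real_derivative
      (1 * flat_exp (k + 2) ((x - p) * (q - x)) + 0
        + (- real k * flat_exp (k + 1) ((x - p) * (q - x)) + 0)) * (- 2 * x + (p + q))) (at x)"
    for k x
    by (rule DERIV_chain'[OF _ flat_exp_deriv, THEN DERIV_cong])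
      (auto intro!: derivative_eq_intros simp: algebra_simps)
  {
    case 0
    show ?case
      using deriv[of k] by (auto simp flip: C_nat_eq_C_holder_0 simp: C_nat_0
          intro!: continuous_at_imp_continuous_on DERIV_isCont)
  next
    case (Suc r)
    show ?case
    proof (rule C_holder_SucI)
      show "(\<lambda>x. (1 * flat_exp (k + 2) ((x - p) * (q - x)) + 0
        + (- real k * flat_exp (k + 1) ((x - p) * (q - x)) + 0)) * (- 2 * x + (p + q)))
        \<in> C_holder r 0"
        by (rule C_holder_mult C_holder_add C_holder_affine C_holder_ident Suc zero_le_one)+
    qed (rule has_field_derivative_at_within[OF deriv])
  }
qed

lemma C_omega_affine_combination:
  assumes "f \<in> C_omega"
  shows "(\<lambda>x. m * f x + b * x) \<in> C_omega"
  unfolding C_omega_def mem_Collect_eq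
proof
  fix x :: real assume "x \<in> unit_Icc"
  then obtain e a where e: "e > 0"
    and a: "\<And>y. y \<in> unit_Icc \<Longrightarrow> \<bar>y - x\<bar> < e \<Longrightarrow> (\<lambda>n. a n * (y - x) ^ n) sums f y"
    using assms unfolding C_omega_def by blast
  define l where "l = (\<lambda>n :: nat. if n = 0 then b * x else if n = 1 then b else 0)"
  have l: "(\<lambda>n. l n * (y - x) ^ n) sums (b * y)" for y
    using sums_finite[of "{0, 1}" "\<lambda>n. l n * (y - x) ^ n"] by (simp add: l_def algebra_simps)
  have "(\<lambda>n. (m * a n + l n) * (y - x) ^ n) sums (m * f y + b * y)"
    if "y \<in> unit_Icc" "\<bar>y - x\<bar> < e" for y
    using sums_add[OF sums_mult[OF a[OF that], of m] l[of y]] by (simp add: algebra_simps)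
  then show "\<exists>e>0. \<exists>a. \<forall>y\<in>unit_Icc. \<bar>y - x\<bar> < e \<longrightarrow> (\<lambda>n. a n * (y - x) ^ n) sums (m * f y + b * y)"
    using e by (intro exI[of _ e] conjI exI[of _ "\<lambda>n. m * a n + l n"]) auto
qed

text \<open>
  A nonconstant power series has isolated zeros, so a function that vanishes on one side of a point
  and nowhere on the other side has no power series expansion there.
\<close>

lemma not_C_omega_if_one_sided_zero:
  assumes p: "0 < p" "p < q" "q \<le> 1"
    and left: "\<And>x. 0 \<le> x \<Longrightarrow> x \<le> p \<Longrightarrow> v x = 0"
    and right: "\<And>x. p < x \<Longrightarrow> x < q \<Longrightarrow> v x \<noteq> 0"
  shows "v \<notin> C_omega"
proof
  assume "v \<in> C_omega"
  moreover have "p \<in> unit_Icc" using p by auto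
  ultimately obtain e a where e: "e > 0"
    and a: "\<And>y. y \<in> unit_Icc \<Longrightarrow> \<bar>y - p\<bar> < e \<Longrightarrow> (\<lambda>n. a n * (y - p) ^ n) sums v y"
    unfolding C_omega_def by blast
  define d where "d = min e (min p (q - p))"
  have d: "d > 0" "d \<le> p" "d \<le> q - p" "d \<le> e" using e p by (auto simp: d_def)
  have sums: "(\<lambda>n. a n * (y - p) ^ n) sums v y" if "norm (y - p) < d" for y
    using that d p by (intro a) auto
  show False
  proof (cases "\<exists>m>0. a m \<noteq> 0")
    case True
    then obtain m where m: "a m \<noteq> 0" "m > 0" by blast
    have "v p = 0" using left p by simp
    from powser_0_nonzero[OF d(1) sums this m] obtain s where s: "0 < s"
      "\<And>z. z \<in> cball p s - {p} \<Longrightarrow> v z \<noteq> 0" by blast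
    define z where "z = p - min s p / 2"
    have "z \<in> cball p s - {p}" "0 \<le> z" "z \<le> p"
      using s(1) p by (auto simp: z_def dist_real_def min_def)
    then show False using s(2) left by blast
  next
    case False
    then have a0: "a n = 0" if "n \<noteq> 0" for n using that by blast
    have "v (p + d / 2) = a 0"
    proof -
      have "(\<lambda>n. a n * d' ^ n) sums a 0" for d' :: real
      proof -
        have "(\<lambda>n. a n * d' ^ n) sums (\<Sum>n\<in>{0}. a n * d' ^ n)"
          by (rule sums_finite) (use a0 in auto)
        then show ?thesis by simp
      qed
      moreover have "norm (p + d / 2 - p) < d" using d(1) by simp
      ultimately show ?thesis using sums sums_unique2 by blast
    qed
    moreover have "v p = a 0"
      using sums[of p] d(1) powser_sums_zero[of a] sums_unique2 by simp
    ultimately show False using left[of p] right[of "p + d / 2"] d p by auto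
  qed
qed

lemma ex_bump:
  assumes s: "1 \<le> s" and pq: "0 < p" "p < q" "q < 1"
  obtains v where "v \<in> C_class s"
    and "\<And>x. x \<in> unit_Icc \<Longrightarrow> x \<notin> {p<..<q} \<Longrightarrow> v x = 0 \<and> deriv_unit v x = 0"
    and "if s = \<infinity> then v \<notin> C_omega else \<forall>t>s. v \<notin> C_class t"
proof (cases "s = \<infinity>")
  case True
  define v where "v = (\<lambda>x. flat_exp 0 ((x - p) * (q - x)))"
  have out: "(x - p) * (q - x) \<le> 0" if "x \<notin> {p<..<q}" for x
    using that pq by (auto simp: mult_le_0_iff)
  show ?thesis
  proof (rule that[of v])
    show "v \<in> C_class s"
      unfolding True C_class_infinity v_def using flat_exp_quadratic_smooth by blast
    show "v x = 0 \<and> deriv_unit v x = 0" if "x \<in> unit_Icc" "x \<notin> {p<..<q}" for x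
    proof -
      have "((\<lambda>x. (x - p) * (q - x)) has_real_derivative (p + q - 2 * x)) (at x within unit_Icc)"
        by (auto intro!: derivative_eq_intros)
      from DERIV_chain'[OF this flat_exp_deriv[of 0]]
      have "(v has_real_derivative 0) (at x within unit_Icc)"
        using out[OF that(2)] by (simp add: v_def flat_exp_def)
      then show ?thesis using deriv_unit_eqI that out[OF that(2)] by (simp add: v_def flat_exp_def)
    qed
    have "v \<notin> C_omega"
    proof (rule not_C_omega_if_one_sided_zero[of p q])
      show "v x \<noteq> 0" if "p < x" "x < q" for x
      proof -
        have "(x - p) * (q - x) > 0" using that by simp
        then show ?thesis by (simp add: v_def flat_exp_def)
      qed
    qed (use pq out in \<open>auto simp: v_def flat_exp_def\<close>)
    then show "if s = \<infinity> then v \<notin> C_omega else \<forall>t>s. v \<notin> C_class t" using True by simp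
  qed
next
  case False
  then show ?thesis using ex_bump_finite[OF s False pq] that by (metis (full_types))
qed

section \<open>Diffeomorphisms supported in the central gap\<close>

text \<open>
  Self-maps of class \<open>s\<close> that are the identity to first order outside the central gap, with
  derivative close to \<open>1\<close>. The bound \<open>3/2\<close> keeps \<open>c * h\<close> a contraction for \<open>c < 1/2\<close>; the bound
  \<open>1/2\<close> makes \<open>h\<close> a diffeomorphism.
\<close>

definition gap_diffeo :: "real \<Rightarrow> ereal \<Rightarrow> (real \<Rightarrow> real) \<Rightarrow> bool" where
  "gap_diffeo c s h \<longleftrightarrow> h \<in> C_class s \<and>
     (\<forall>x\<in>unit_Icc. 1/2 \<le> deriv_unit h x \<and> deriv_unit h x \<le> 3/2) \<and>
     (\<forall>x\<in>unit_Icc - {c<..<1 - c}. h x = x \<and> deriv_unit h x = 1)"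

lemma gap_diffeo_ident:
  assumes "1 \<le> s" shows "gap_diffeo c s (\<lambda>x. x)"
proof -
  have "deriv_unit (\<lambda>x. x) x = 1" if "x \<in> unit_Icc" for x
    by (rule deriv_unit_eqI[OF that]) (auto intro!: derivative_eq_intros)
  then show ?thesis using C_class_ident[OF assms] by (simp add: gap_diffeo_def)
qed

lemma ex_irregular_gap_diffeo:
  assumes c: "0 < c" "c < 1/2" and s: "1 \<le> s"
  obtains h where "gap_diffeo c s h" "\<exists>x\<in>unit_Icc. h x \<noteq> x"
    "if s = \<infinity> then (\<lambda>x. c * h x) \<notin> C_omega else \<forall>t>s. (\<lambda>x. c * h x) \<notin> C_class t"
proof -
  obtain v where v: "v \<in> C_class s"
    and out: "\<And>x. x \<in> unit_Icc \<Longrightarrow> x \<notin> {c<..<1 - c} \<Longrightarrow> v x = 0 \<and> deriv_unit v x = 0"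
    and irr: "if s = \<infinity> then v \<notin> C_omega else \<forall>t>s. v \<notin> C_class t"
    using ex_bump[OF s, of c "1 - c"] c by auto
  have v': "(v has_real_derivative deriv_unit v x) (at x within unit_Icc)" if "x \<in> unit_Icc" for x
    using differentiable_on_deriv_unit[OF C_class_differentiable[OF s v] that] .
  have "continuous_on unit_Icc (deriv_unit v)"
    using C_class_imp_C1[OF s v] C_holder_continuous by (auto simp: C_holder_Suc)
  then obtain B where B: "B > 0" "\<And>x. x \<in> unit_Icc \<Longrightarrow> \<bar>deriv_unit v x\<bar> \<le> B"
    by (rule continuous_unit_bounded) blast
  define e where "e = 1 / (2 * B)"
  have e: "e > 0" using B(1) by (simp add: e_def)
  \<comment> \<open>the summand \<open>0\<close> matches the form of \<open>C_class_affine\<close>\<close>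
  define h where "h = (\<lambda>x. x + (e * v x + 0))"
  have h_eq: "h x = x + e * v x" for x by (simp add: h_def)
  have hC: "h \<in> C_class s"
    unfolding h_def by (intro C_class_add[OF s C_class_ident[OF s]] C_class_affine[OF s v])
  have dh: "deriv_unit h x = 1 + e * deriv_unit v x" if "x \<in> unit_Icc" for x
    using v'[OF that] unfolding h_def
    by (intro deriv_unit_eqI[OF that]) (auto intro!: derivative_eq_intros)
  have eB: "\<bar>e * deriv_unit v x\<bar> \<le> 1/2" if "x \<in> unit_Icc" for x
  proof -
    have "\<bar>e * deriv_unit v x\<bar> \<le> e * B"
      using B(2)[OF that] e by (simp add: abs_mult)
    then show ?thesis using B(1) by (simp add: e_def)
  qed
  have "1/2 \<le> deriv_unit h x \<and> deriv_unit h x \<le> 3/2" if "x \<in> unit_Icc" for x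
    using eB[OF that] dh[OF that] by linarith
  moreover have "h x = x \<and> deriv_unit h x = 1" if "x \<in> unit_Icc" "x \<notin> {c<..<1 - c}" for x
    using out[OF that] dh[OF that(1)] by (simp add: h_eq)
  ultimately have "gap_diffeo c s h" using hC by (auto simp: gap_diffeo_def)
  moreover have "\<exists>x\<in>unit_Icc. h x \<noteq> x"
  proof (rule ccontr)
    assume "\<not> ?thesis"
    then have v0: "v x = 0" if "x \<in> unit_Icc" for x using that e by (auto simp: h_eq)
    have "v \<in> C_class \<infinity>"
      using C_class_cong[of \<infinity> v "\<lambda>x. 0 * x + 0"] C_class_affine[OF _ C_class_ident, of \<infinity> 0 0] v0 by simp
    moreover have "v \<in> C_omega"
      unfolding C_omega_def using v0 by (auto intro!: exI[of _ 1] exI[of _ "\<lambda>_. 0"])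
    ultimately show False using irr by (auto split: if_splits)
  qed
  moreover have v_h: "v = (\<lambda>x. 1 / (c * e) * (c * h x) + (- 1 / e) * x)"
    using c e by (auto simp: h_eq field_simps)
  moreover have "if s = \<infinity> then (\<lambda>x. c * h x) \<notin> C_omega else \<forall>t>s. (\<lambda>x. c * h x) \<notin> C_class t"
  proof (cases "s = \<infinity>")
    case True
    then show ?thesis
      using irr v_h C_omega_affine_combination[of "\<lambda>x. c * h x" "1 / (c * e)" "- 1 / e"] by auto
  next
    case False
    have "v \<in> C_class t" if "s < t" "(\<lambda>x. c * h x) \<in> C_class t" for t
    proof -
      have t: "1 \<le> t" using s that(1) by simp
      have "(\<lambda>x. (1 / (c * e) * (c * h x) + 0) + ((- 1 / e) * x + 0)) \<in> C_class t"
        by (intro C_class_add[OF t] C_class_affine[OF t that(2)] C_class_affine[OF t C_class_ident[OF t]])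
      then show ?thesis by (subst v_h) simp
    qed
    then show ?thesis using irr False by auto
  qed
  ultimately show ?thesis using that by blast
qed

context
  fixes c :: real and s :: ereal and h :: "real \<Rightarrow> real"
  assumes c: "0 < c" "c < 1/2" and s: "1 \<le> s" and h: "gap_diffeo c s h"
begin

lemma gap_diffeo_deriv:
  assumes "x \<in> unit_Icc"
  shows "(h has_real_derivative deriv_unit h x) (at x within unit_Icc)"
  using differentiable_on_deriv_unit[OF C_class_differentiable[OF s] assms] h
  by (simp add: gap_diffeo_def)

lemma gap_diffeo_eq:
  assumes "0 \<le> x" "x \<le> 1" "x \<le> c \<or> 1 - c \<le> x"
  shows "h x = x" "deriv_unit h x = 1"
  using h assms by (auto simp: gap_diffeo_def)

lemma gap_diffeo_expanding:
  assumes "x \<in> unit_Icc" "y \<in> unit_Icc" "x \<le> y"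
  shows "1/2 * (y - x) \<le> h y - h x"
  by (rule unit_deriv_lower_bound[OF gap_diffeo_deriv _ assms]) (use h in \<open>auto simp: gap_diffeo_def\<close>)

lemma gap_diffeo_bij: "bij_betw h unit_Icc unit_Icc"
proof -
  have "inj_on h unit_Icc"
  proof (rule linorder_inj_onI)
    fix x y assume "x < y" "x \<in> unit_Icc" "y \<in> unit_Icc"
    then show "h x \<noteq> h y" using gap_diffeo_expanding[of x y] by auto
  qed auto
  moreover have "h x \<in> unit_Icc" if "x \<in> unit_Icc" for x
    using gap_diffeo_expanding[of 0 x] gap_diffeo_expanding[of x 1] gap_diffeo_eq(1)[of 0]
      gap_diffeo_eq(1)[of 1] c that by auto
  then have "h ` unit_Icc \<subseteq> unit_Icc" by blast
  moreover have "unit_Icc \<subseteq> h ` unit_Icc"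
  proof
    fix y :: real assume "y \<in> unit_Icc"
    moreover have "continuous_on unit_Icc h" by (rule DERIV_continuous_on[OF gap_diffeo_deriv])
    ultimately have "\<exists>x\<ge>0. x \<le> 1 \<and> h x = y"
      using gap_diffeo_eq(1)[of 0] gap_diffeo_eq(1)[of 1] c by (intro IVT') auto
    then show "y \<in> h ` unit_Icc" by auto
  qed
  ultimately show ?thesis by (simp add: bij_betw_def subset_antisym)
qed

lemma gap_diffeo_mem: "x \<in> unit_Icc \<Longrightarrow> h x \<in> unit_Icc"
  using gap_diffeo_bij bij_betwE by blast

lemma gap_diffeo_C_diffeo: "C_diffeo s h"
proof -
  have "inv_into unit_Icc h y \<in> unit_Icc \<and> h (inv_into unit_Icc h y) = y" if "y \<in> unit_Icc" for y
    using inv_into_into[of y h unit_Icc] f_inv_into_f[of y h unit_Icc] gap_diffeo_bij that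
    by (simp add: bij_betw_def)
  moreover have "(h has_real_derivative deriv_unit h x) (at x within unit_Icc) \<and> 1/2 \<le> deriv_unit h x"
    if "x \<in> unit_Icc" for x
    using that gap_diffeo_deriv h by (auto simp: gap_diffeo_def)
  ultimately have "inv_into unit_Icc h \<in> C_class s"
    using h s by (rule_tac C_class_inverse_function[OF s, of h "1/2" "deriv_unit h"]) (auto simp: gap_diffeo_def)
  then show ?thesis using h gap_diffeo_bij by (simp add: C_diffeo_def gap_diffeo_def)
qed

lemma gap_diffeo_branch:
  assumes b: "0 \<le> b" "b \<le> 1 - c"
  shows "(\<lambda>x. c * h x + b) \<in> C_class s"
    and "x \<in> unit_Icc \<Longrightarrow> c * h x + b \<in> {b..b + c}"
    and "x \<in> unit_Icc \<Longrightarrow> deriv_unit (\<lambda>x. c * h x + b) x = c * deriv_unit h x"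
    and "x \<in> unit_Icc \<Longrightarrow> y \<in> unit_Icc \<Longrightarrow> \<bar>(c * h x + b) - (c * h y + b)\<bar> \<le> 3/4 * \<bar>x - y\<bar>"
    and "0 < (INF t\<in>unit_Icc. \<bar>deriv_unit (\<lambda>x. c * h x + b) t\<bar>)"
    and "(INF t\<in>unit_Icc. \<bar>deriv_unit (\<lambda>x. c * h x + b) t\<bar>) \<le>
      (SUP t\<in>unit_Icc. \<bar>deriv_unit (\<lambda>x. c * h x + b) t\<bar>)"
    and "(SUP t\<in>unit_Icc. \<bar>deriv_unit (\<lambda>x. c * h x + b) t\<bar>) < 1"
proof -
  let ?f = "\<lambda>x. c * h x + b"
  show "?f \<in> C_class s" using C_class_affine[OF s] h by (simp add: gap_diffeo_def)
  show "x \<in> unit_Icc \<Longrightarrow> ?f x \<in> {b..b + c}"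
    using gap_diffeo_mem[of x] c by (auto simp: mult_left_le)
  have has_deriv: "(?f has_real_derivative c * deriv_unit h x) (at x within unit_Icc)"
    if "x \<in> unit_Icc" for x
    using gap_diffeo_deriv[OF that] by (auto intro!: derivative_eq_intros)
  then show deriv: "deriv_unit ?f x = c * deriv_unit h x" if "x \<in> unit_Icc" for x
    using that deriv_unit_eqI by blast
  have bounds: "c / 2 \<le> \<bar>deriv_unit ?f x\<bar>" "\<bar>deriv_unit ?f x\<bar> \<le> 3/4" if "x \<in> unit_Icc" for x
  proof -
    have "1/2 \<le> deriv_unit h x" "deriv_unit h x \<le> 3/2" using h that by (auto simp: gap_diffeo_def)
    then have "c * (1/2) \<le> c * deriv_unit h x" "c * deriv_unit h x \<le> 1/2 * (3/2)"
      using c by (intro mult_mono; simp)+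
    then show "c / 2 \<le> \<bar>deriv_unit ?f x\<bar>" "\<bar>deriv_unit ?f x\<bar> \<le> 3/4"
      using c by (auto simp: deriv[OF that])
  qed
  show "\<bar>?f x - ?f y\<bar> \<le> 3/4 * \<bar>x - y\<bar>" if "x \<in> unit_Icc" "y \<in> unit_Icc" for x y
    using field_differentiable_bound[of unit_Icc ?f "\<lambda>x. c * deriv_unit h x" "3/4" x y]
      has_deriv bounds(2) deriv that by auto
  let ?D = "(\<lambda>t. \<bar>deriv_unit ?f t\<bar>) ` unit_Icc"
  have "c / 2 \<le> Inf ?D" using bounds(1) by (intro cINF_greatest) auto
  then show "0 < Inf ?D" using c by linarith
  have "Sup ?D \<le> 3/4" using bounds(2) by (intro cSUP_least) auto
  then show "Sup ?D < 1" by linarith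
  have "bdd_below ?D" "bdd_above ?D"
    using bounds unfolding bdd_below_def bdd_above_def by fast+
  then show "Inf ?D \<le> Sup ?D" by (intro cInf_le_cSup) auto
qed

end

section \<open>Attractors\<close>

text \<open>
  Existence of the attractor is shown without the Hausdorff metric: it is the closure of the orbit of
  a fixed point of one of the maps. Uniqueness holds because any invariant set is contained in
  the \<open>k ^ n\<close>-neighbourhood of any other one, for all \<open>n\<close>.
\<close>

lemma ex1_attractor:
  fixes \<Phi> :: "(real \<Rightarrow> real) set"
  assumes fin: "finite \<Phi>" and k: "0 \<le> k" "k < 1"
    and into: "\<And>f x. f \<in> \<Phi> \<Longrightarrow> x \<in> unit_Icc \<Longrightarrow> f x \<in> unit_Icc"
    and contr: "\<And>f x y. f \<in> \<Phi> \<Longrightarrow> x \<in> unit_Icc \<Longrightarrow> y \<in> unit_Icc \<Longrightarrow> \<bar>f x - f y\<bar> \<le> k * \<bar>x - y\<bar>"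
    and fixpoint: "g \<in> \<Phi>" "z \<in> unit_Icc" "g z = z"
  shows "\<exists>!X. X \<noteq> {} \<and> compact X \<and> X \<subseteq> unit_Icc \<and> X = (\<Union>f\<in>\<Phi>. f ` X)"
proof (rule ex_ex1I)
  have cont: "continuous_on unit_Icc f" if "f \<in> \<Phi>" for f
    by (rule lipschitz_on_continuous_on[of k])
      (use contr[OF that] k in \<open>auto simp: lipschitz_on_def dist_real_def\<close>)
  define S where "S = \<Inter>{A. z \<in> A \<and> (\<forall>f\<in>\<Phi>. f ` A \<subseteq> A)}"
  have zS: "z \<in> S" and inv: "\<And>f. f \<in> \<Phi> \<Longrightarrow> f ` S \<subseteq> S" by (auto simp: S_def)
  have min: "S \<subseteq> A" if "z \<in> A" "\<And>f. f \<in> \<Phi> \<Longrightarrow> f ` A \<subseteq> A" for A using that by (auto simp: S_def)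
  have SI: "S \<subseteq> unit_Icc" by (rule min) (use fixpoint into in auto)
  have cl: "closure S \<subseteq> unit_Icc" using SI by (simp add: closure_minimal)
  have comp: "compact (closure S)"
    using SI bounded_subset[of unit_Icc S] by (simp add: compact_closure)
  have contS: "continuous_on (closure S) f" if "f \<in> \<Phi>" for f
    using cont[OF that] cl continuous_on_subset by blast
  have "S \<subseteq> (\<Union>f\<in>\<Phi>. f ` S)"
  proof (rule min)
    have "g z \<in> g ` S" using zS by blast
    then show "z \<in> (\<Union>f\<in>\<Phi>. f ` S)" using fixpoint(1,3) by auto
    have "(\<Union>f\<in>\<Phi>. f ` S) \<subseteq> S" using inv by blast
    then show "f ` (\<Union>f\<in>\<Phi>. f ` S) \<subseteq> (\<Union>f\<in>\<Phi>. f ` S)" if "f \<in> \<Phi>" for f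
      using that by blast
  qed
  then have "S \<subseteq> (\<Union>f\<in>\<Phi>. f ` closure S)"
    by (rule order_trans) (intro UN_mono image_mono closure_subset subset_refl)
  moreover have "closed (\<Union>f\<in>\<Phi>. f ` closure S)"
    using fin compact_imp_closed[OF compact_continuous_image[OF contS comp]] by (intro closed_UN) auto
  ultimately have "closure S \<subseteq> (\<Union>f\<in>\<Phi>. f ` closure S)" by (rule closure_minimal)
  moreover have "f ` closure S \<subseteq> closure S" if "f \<in> \<Phi>" for f
    using image_closure_subset[OF contS[OF that] closed_closure] inv[OF that] closure_subset by blast
  ultimately have "closure S = (\<Union>f\<in>\<Phi>. f ` closure S)" by blast
  then show "\<exists>X. X \<noteq> {} \<and> compact X \<and> X \<subseteq> unit_Icc \<and> X = (\<Union>f\<in>\<Phi>. f ` X)"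
    using zS comp cl closure_subset by (intro exI[of _ "closure S"]) auto
next
  have sub: "X \<subseteq> Y"
    if X: "X \<subseteq> unit_Icc" "X = (\<Union>f\<in>\<Phi>. f ` X)"
      and Y: "Y \<noteq> {}" "compact Y" "Y \<subseteq> unit_Icc" "Y = (\<Union>f\<in>\<Phi>. f ` Y)" for X Y
  proof
    have approx: "\<exists>y\<in>Y. \<bar>x - y\<bar> \<le> k ^ n" if "x \<in> X" for x n
      using that
    proof (induction n arbitrary: x)
      case 0
      obtain y where "y \<in> Y" using Y(1) by blast
      moreover have "x \<in> unit_Icc" "y \<in> unit_Icc" using 0 X(1) \<open>y \<in> Y\<close> Y(3) by blast+
      ultimately show ?case by (intro bexI[of _ y]) auto
    next
      case (Suc n)
      then obtain f x' where f: "f \<in> \<Phi>" "x' \<in> X" "x = f x'" using X(2) by blast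
      obtain y where y: "y \<in> Y" "\<bar>x' - y\<bar> \<le> k ^ n" using Suc.IH[OF f(2)] by blast
      have "\<bar>f x' - f y\<bar> \<le> k * \<bar>x' - y\<bar>" using contr[OF f(1)] f(2) y(1) X(1) Y(3) by blast
      also have "\<dots> \<le> k ^ Suc n" using y(2) k by (simp add: mult_left_mono)
      finally show ?case using f y(1) Y(4) by blast
    qed
    fix x assume "x \<in> X"
    have "\<exists>y\<in>Y. dist y x < e" if "e > 0" for e
    proof -
      obtain n where "k ^ n < e" using real_arch_pow_inv[OF \<open>e > 0\<close> k(2)] by blast
      then show ?thesis using approx[OF \<open>x \<in> X\<close>, of n] by (force simp: dist_real_def abs_minus_commute)
    qed
    then have "x \<in> closure Y" by (simp add: closure_approachable)
    then show "x \<in> Y" using Y(2) compact_imp_closed closure_closed by blast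
  qed
  fix X Y
  assume X: "X \<noteq> {} \<and> compact X \<and> X \<subseteq> unit_Icc \<and> X = (\<Union>f\<in>\<Phi>. f ` X)"
    and Y: "Y \<noteq> {} \<and> compact Y \<and> Y \<subseteq> unit_Icc \<and> Y = (\<Union>f\<in>\<Phi>. f ` Y)"
  have "X \<subseteq> Y" by (rule sub) (use X Y in blast)+
  moreover have "Y \<subseteq> X" by (rule sub) (use X Y in blast)+
  ultimately show "X = Y" by blast
qed

section \<open>The iterated function systems\<close>

text \<open>
  The affine system with slope \<open>c\<close>, its two maps precomposed with \<open>h\<close> and \<open>k\<close> respectively.
\<close>

definition gap_IFS :: "real \<Rightarrow> (real \<Rightarrow> real) \<Rightarrow> (real \<Rightarrow> real) \<Rightarrow> (real \<Rightarrow> real) set" where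
  "gap_IFS c h k = {\<lambda>x. c * h x, \<lambda>x. c * k x + (1 - c)}"

lemma gap_IFS_memE:
  assumes "f \<in> gap_IFS c h k"
  obtains g b where "f = (\<lambda>x. c * g x + b)" "g = h \<and> b = 0 \<or> g = k \<and> b = 1 - c"
proof -
  from assms consider "f = (\<lambda>x. c * h x)" | "f = (\<lambda>x. c * k x + (1 - c))"
    by (auto simp: gap_IFS_def)
  then show ?thesis using that[of h 0] that[of k "1 - c"] by cases auto
qed

context
  fixes c :: real and s :: ereal and h k :: "real \<Rightarrow> real"
  assumes c: "0 < c" "c < 1/2" and s: "1 \<le> s"
    and h: "gap_diffeo c s h" and k: "gap_diffeo c s k"
begin

lemma gap_IFS_mem:
  assumes "f \<in> gap_IFS c h k"
  obtains g b where "f = (\<lambda>x. c * g x + b)" "gap_diffeo c s g" "b = 0 \<or> b = 1 - c"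
  using assms by (rule gap_IFS_memE) (use that h k in metis)

lemma hyperbolic_gap_IFS: "hyperbolic_IFS s (gap_IFS c h k)"
proof -
  have "f \<in> C_class s \<and> f ` unit_Icc \<subseteq> unit_Icc \<and>
        0 < (INF t\<in>unit_Icc. \<bar>deriv_unit f t\<bar>) \<and>
        (INF t\<in>unit_Icc. \<bar>deriv_unit f t\<bar>) \<le> (SUP t\<in>unit_Icc. \<bar>deriv_unit f t\<bar>) \<and>
        (SUP t\<in>unit_Icc. \<bar>deriv_unit f t\<bar>) < 1" if fP: "f \<in> gap_IFS c h k" for f
  proof -
    obtain g b where f: "f = (\<lambda>x. c * g x + b)" and g: "gap_diffeo c s g" and "b = 0 \<or> b = 1 - c"
      using fP by (rule gap_IFS_mem)
    then have b: "0 \<le> b" "b \<le> 1 - c" using c by auto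
    note branch = gap_diffeo_branch[OF c s g b]
    have "f ` unit_Icc \<subseteq> unit_Icc" using branch(2) b unfolding f by fastforce
    then show ?thesis using branch(1,5-7) unfolding f by blast
  qed
  moreover have "h 0 = 0" "h 1 = 1" "k 0 = 0" "k 1 = 1"
    using gap_diffeo_eq(1)[OF c s h] gap_diffeo_eq(1)[OF c s k] c by auto
  ultimately show ?thesis
    unfolding hyperbolic_IFS_def
    by (intro exI[of _ "\<lambda>x. c * h x"] exI[of _ "\<lambda>x. c * k x + (1 - c)"])
      (use c in \<open>auto simp: gap_IFS_def\<close>)
qed

lemma pseudo_affine_gap_IFS: "pseudo_affine c (gap_IFS c h k)"
proof -
  let ?\<Phi> = "gap_IFS c h k"
  have mem: "f x \<in> unit_Icc - {c<..<1 - c}" if fP: "f \<in> ?\<Phi>" and xX: "x \<in> unit_Icc" for f x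
  proof -
    obtain g b where f: "f = (\<lambda>x. c * g x + b)" and g: "gap_diffeo c s g" and b: "b = 0 \<or> b = 1 - c"
      using fP by (rule gap_IFS_mem)
    have "c * g x + b \<in> {b..b + c}"
      by (rule gap_diffeo_branch(2)[OF c s g]) (use b c xX in auto)
    then have "b \<le> f x" "f x \<le> b + c" unfolding f by (simp_all only: atLeastAtMost_iff)
    then show ?thesis using b c by auto
  qed
  have "\<exists>!X. X \<noteq> {} \<and> compact X \<and> X \<subseteq> unit_Icc \<and> X = (\<Union>f\<in>?\<Phi>. f ` X)"
  proof (rule ex1_attractor[where k = "3/4" and z = 0])
    show "finite ?\<Phi>" "(\<lambda>x. c * h x) \<in> ?\<Phi>" by (auto simp: gap_IFS_def)
    show "c * h 0 = 0" using gap_diffeo_eq(1)[OF c s h, of 0] c by simp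
    show "\<bar>f x - f y\<bar> \<le> 3/4 * \<bar>x - y\<bar>" if fP: "f \<in> ?\<Phi>" and xX: "x \<in> unit_Icc" "y \<in> unit_Icc" for f x y
    proof -
      obtain g b where f: "f = (\<lambda>x. c * g x + b)" and g: "gap_diffeo c s g" and b: "b = 0 \<or> b = 1 - c"
        using fP by (rule gap_IFS_mem)
      then show ?thesis using gap_diffeo_branch(4)[OF c s g, of b x y] c xX by auto
    qed
  qed (use mem in auto)
  from theI'[OF this] have X: "attractor ?\<Phi> \<subseteq> unit_Icc"
    "attractor ?\<Phi> = (\<Union>f\<in>?\<Phi>. f ` attractor ?\<Phi>)"
    unfolding attractor_def[symmetric] by blast+
  have "deriv_unit f x = c" if fP: "f \<in> ?\<Phi>" and xX: "x \<in> attractor ?\<Phi>" for f x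
  proof -
    obtain f' y where "f' \<in> ?\<Phi>" "y \<in> attractor ?\<Phi>" "x = f' y"
      using subsetD[OF equalityD1[OF X(2)] xX] by blast
    then have x: "x \<in> unit_Icc - {c<..<1 - c}" using X(1) mem by blast
    obtain g b where f: "f = (\<lambda>x. c * g x + b)" and g: "gap_diffeo c s g" and b: "b = 0 \<or> b = 1 - c"
      using fP by (rule gap_IFS_mem)
    have "deriv_unit f x = c * deriv_unit g x"
      unfolding f using gap_diffeo_branch(3)[OF c s g, of b x] b c x by auto
    then show ?thesis using gap_diffeo_eq(2)[OF c s g, of x] x by auto
  qed
  then show ?thesis by (simp add: pseudo_affine_def)
qed

lemma no_more_regular_gap_IFS:
  assumes "if s = \<infinity> then (\<lambda>x. c * h x) \<notin> C_omega else \<forall>t>s. (\<lambda>x. c * h x) \<notin> C_class t"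
  shows "no_more_regular s (gap_IFS c h k)"
  using assms by (auto simp: no_more_regular_def gap_IFS_def)

end

section \<open>Conjugacy to self-similar systems\<close>

lemma self_similar_gap_IFS_ident: "self_similar (gap_IFS c (\<lambda>x. x) (\<lambda>x. x))"
proof -
  have "\<exists>a b. \<forall>x\<in>unit_Icc. f x = a * x + b" if "f \<in> gap_IFS c (\<lambda>x. x) (\<lambda>x. x)" for f
    using that by (rule gap_IFS_memE) auto
  then show ?thesis by (simp add: self_similar_def)
qed

text \<open>
  The conjugacy is \<open>h\<close> itself, since it fixes every point in the images of the two affine maps.
\<close>

lemma conjugated_gap_IFS:
  assumes c: "0 < c" "c < 1/2" and s: "1 \<le> s" and h: "gap_diffeo c s h"
  shows "conjugated_to_self_similar s (gap_IFS c h h)"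
proof -
  have bij: "bij_betw h unit_Icc unit_Icc" by (rule gap_diffeo_bij[OF c s h])
  let ?g = "inv_into unit_Icc h"
  have g: "?g x \<in> unit_Icc" "h (?g x) = x" if "x \<in> unit_Icc" for x
    using inv_into_into[of x h unit_Icc] f_inv_into_f[of x h unit_Icc] bij that
    by (simp_all add: bij_betw_def)
  have conj: "restrict (h \<circ> (\<lambda>x. c * h x + b) \<circ> ?g) unit_Icc = restrict (\<lambda>x. c * x + b) unit_Icc"
    if b: "b = 0 \<or> b = 1 - c" for b
  proof (rule restrict_ext)
    fix x :: real assume x: "x \<in> unit_Icc"
    have "h z = z" if "b \<le> z" "z \<le> b + c" for z
      using b c that by (intro gap_diffeo_eq(1)[OF c s h]) auto
    then have "h (c * x + b) = c * x + b" using x c by (simp add: mult_left_le)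
    then show "(h \<circ> (\<lambda>x. c * h x + b) \<circ> ?g) x = c * x + b" using g(2)[OF x] by simp
  qed
  have "C_conjugated s (gap_IFS c h h) (gap_IFS c (\<lambda>x. x) (\<lambda>x. x))"
    unfolding C_conjugated_def
    using gap_diffeo_C_diffeo[OF c s h] conj[of 0] conj[of "1 - c"]
    by (intro exI[of _ h]) (simp add: gap_IFS_def)
  then show ?thesis
    unfolding conjugated_to_self_similar_def
    using hyperbolic_gap_IFS[OF c s gap_diffeo_ident[OF s] gap_diffeo_ident[OF s]]
      self_similar_gap_IFS_ident by blast
qed

text \<open>
  If \<open>h\<close> is the identity near the fixed point \<open>0\<close>, then iterating \<open>k (c * h x) = a * k x\<close> gives
  \<open>k (c ^ n * h x) = a ^ n * k x\<close>. Divided by \<open>c ^ n\<close>, the left-hand side tends to \<open>d * h x\<close>; hence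
  \<open>k\<close> is proportional to \<open>h\<close>, and the normalization at \<open>1\<close> makes them equal. The derivative \<open>d\<close> must
  be nonzero, but no relation between \<open>a\<close> and \<open>c\<close> is presupposed.
\<close>

lemma linearization_unique:
  fixes h k :: "real \<Rightarrow> real"
  assumes c: "0 < c" "c < 1"
    and k: "(k has_real_derivative d) (at 0 within unit_Icc)" "d \<noteq> 0" "k 0 = 0" "k 1 = 1"
    and h: "\<And>x. x \<in> unit_Icc \<Longrightarrow> h x \<in> unit_Icc" "h 1 = 1" "\<And>x. 0 \<le> x \<Longrightarrow> x \<le> c \<Longrightarrow> h x = x"
    and eq: "\<And>x. x \<in> unit_Icc \<Longrightarrow> k (c * h x) = a * k x"
    and x: "x \<in> unit_Icc"
  shows "k x = h x"
proof -
  have c_pow: "0 \<le> c ^ Suc n * y \<and> c ^ Suc n * y \<le> c" if "y \<in> unit_Icc" for n y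
  proof -
    have "c ^ Suc n * y \<le> c ^ 1 * 1" using c that by (intro mult_mono power_decreasing) auto
    then show ?thesis using c that by simp
  qed
  have iter: "k (c ^ Suc n * h x) = a ^ Suc n * k x" if "x \<in> unit_Icc" for n x
  proof (induction n)
    case (Suc n)
    let ?y = "c ^ Suc n * h x"
    have y: "0 \<le> ?y" "?y \<le> c" using c_pow h(1)[OF that] by blast+
    have "k (c ^ Suc (Suc n) * h x) = k (c * h ?y)" using h(3)[OF y] by (simp add: mult.assoc)
    also have "\<dots> = a * k ?y"
    proof (rule eq)
      show "?y \<in> unit_Icc" unfolding atLeastAtMost_iff using y c by linarith
    qed
    finally show ?case using Suc.IH by simp
  qed (use eq that in simp)
  have lim: "(\<lambda>n. (a / c) ^ Suc n * k x) \<longlonglongrightarrow> d * h x" if "x \<in> unit_Icc" for x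
  proof (cases "h x = 0")
    case True
    have "a ^ Suc n * k x = 0" for n using iter[OF that, of n] True k(3) by simp
    then have "(\<lambda>n. (a / c) ^ Suc n * k x) = (\<lambda>_. 0)" by (auto simp: power_divide)
    then show ?thesis using True by simp
  next
    case False
    let ?y = "\<lambda>n. c ^ Suc n * h x"
    have y: "0 \<le> ?y n \<and> ?y n \<le> c" for n using c_pow h(1)[OF that] by blast
    have "(\<lambda>n. c ^ Suc n * h x) \<longlonglongrightarrow> 0 * h x"
      using c LIMSEQ_Suc[OF LIMSEQ_power_zero[of c]] by (intro tendsto_mult tendsto_const) auto
    moreover have "?y n \<in> unit_Icc \<and> ?y n \<noteq> 0" for n
      unfolding atLeastAtMost_iff using y[of n] c False by (intro conjI; (linarith | simp))
    ultimately have "filterlim ?y (at 0 within unit_Icc) sequentially"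
      unfolding filterlim_at mult_zero_left by (intro conjI always_eventually allI) blast+
    moreover have "((\<lambda>y. k y / y) \<longlongrightarrow> d) (at 0 within unit_Icc)"
      using k(1,3) by (simp add: has_field_derivative_iff)
    ultimately have "(\<lambda>n. k (?y n) / ?y n) \<longlonglongrightarrow> d" by (rule filterlim_compose[rotated])
    then have "(\<lambda>n. k (?y n) / ?y n * h x) \<longlonglongrightarrow> d * h x" by (intro tendsto_intros)
    moreover have "k (?y n) / ?y n * h x = (a / c) ^ Suc n * k x" for n
      unfolding iter[OF that] using False c by (simp add: power_divide)
    ultimately show ?thesis by simp
  qed
  have "(\<lambda>n. (a / c) ^ Suc n) \<longlonglongrightarrow> d" using lim[of 1] k(4) h(2) by simp
  then have "(\<lambda>n. (a / c) ^ Suc n * k x) \<longlonglongrightarrow> d * k x" by (intro tendsto_intros)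
  then have "d * k x = d * h x" using lim[OF x] LIMSEQ_unique by blast
  then show ?thesis using k(2) by simp
qed

text \<open>
  A map \<open>k\<close> that linearizes both branches of \<open>gap_IFS c h (\<lambda>x. x)\<close> equals \<open>h\<close> by uniqueness of the
  linearization at \<open>0\<close>, and equals the identity by uniqueness at \<open>1\<close>.
\<close>

lemma gap_IFS_linearization_rigid:
  fixes k :: "real \<Rightarrow> real"
  assumes c: "0 < c" "c < 1/2" and s: "1 \<le> s" and h: "gap_diffeo c s h"
    and k: "(k has_real_derivative d) (at 0 within unit_Icc)" "d \<noteq> 0"
      "(k has_real_derivative d') (at 1 within unit_Icc)" "d' \<noteq> 0"
    and ab: "a \<noteq> 1" "b \<noteq> 1"
    and eq: "\<And>x. x \<in> unit_Icc \<Longrightarrow> k (c * h x) = a * k x"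
      "\<And>x. x \<in> unit_Icc \<Longrightarrow> k (c * x + (1 - c)) = 1 - b * (1 - k x)"
    and x: "x \<in> unit_Icc"
  shows "h x = x"
proof -
  have h01: "h 0 = 0" "h 1 = 1" using gap_diffeo_eq(1)[OF c s h] c by auto
  have k0: "k 0 = 0" using eq(1)[of 0] h01 ab by simp
  have "(1 - b) * (1 - k 1) = 0" using eq(2)[of 1] by (simp add: algebra_simps)
  then have k1: "k 1 = 1" using ab by simp
  have kh: "k x = h x" if "x \<in> unit_Icc" for x
  proof (rule linearization_unique[OF c(1) _ k(1,2) k0 k1 _ _ _ eq(1) that])
    show "h z \<in> unit_Icc" if "z \<in> unit_Icc" for z using gap_diffeo_mem[OF c s h that] .
    show "h z = z" if "0 \<le> z" "z \<le> c" for z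
      using gap_diffeo_eq(1)[OF c s h, of z] that c by simp
  qed (use c h01 in auto)
  \<comment> \<open>reflection moves the fixed point \<open>1\<close> of the second map to \<open>0\<close>\<close>
  define K where "K = (\<lambda>x. 1 - k (1 - x))"
  have refl: "1 - x \<in> unit_Icc" if "x \<in> unit_Icc" for x :: real using that by auto
  have "K (1 - x) = 1 - x"
  proof (rule linearization_unique[where h = "\<lambda>x. x", OF c(1) _ _ k(4) _ _ _ _ _ _ refl[OF x]])
    have "(\<lambda>x :: real. 1 - x) ` unit_Icc = unit_Icc" by simp
    then have "(k has_real_derivative d') (at (1 - 0) within (\<lambda>x. 1 - x) ` unit_Icc)"
      using k(3) by simp
    moreover have "((\<lambda>x. 1 - x) has_real_derivative - 1) (at 0 within unit_Icc)"
      by (auto intro!: derivative_eq_intros)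
    ultimately have "((\<lambda>x. k (1 - x)) has_real_derivative d' * - 1) (at 0 within unit_Icc)"
      using DERIV_image_chain[of k d' "\<lambda>x. 1 - x" 0 unit_Icc "- 1"] by (simp add: o_def)
    then show "(K has_real_derivative d') (at 0 within unit_Icc)"
      unfolding K_def by (auto intro!: derivative_eq_intros)
    show "K (c * x) = b * K x" if "x \<in> unit_Icc" for x
      using eq(2)[OF refl[OF that]] by (simp add: K_def algebra_simps)
  qed (use c k0 k1 in \<open>auto simp: K_def\<close>)
  then have "k x = x" by (simp add: K_def)
  then show ?thesis using kh[OF x] by simp
qed

lemma C_diffeo_deriv_nonzero:
  assumes s: "1 \<le> s" and k: "C_diffeo s k" and x: "x \<in> unit_Icc"
  shows "(k has_real_derivative deriv_unit k x) (at x within unit_Icc)" "deriv_unit k x \<noteq> 0"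
proof -
  let ?g = "inv_into unit_Icc k"
  have bij: "bij_betw k unit_Icc unit_Icc" and C: "k \<in> C_class s" "?g \<in> C_class s"
    using k by (auto simp: C_diffeo_def)
  show dk: "(k has_real_derivative deriv_unit k x) (at x within unit_Icc)"
    by (rule differentiable_on_deriv_unit[OF C_class_differentiable[OF s C(1)] x])
  have kx: "k x \<in> unit_Icc" using bij x bij_betwE by blast
  have "(?g has_real_derivative deriv_unit ?g (k x)) (at (k x) within k ` unit_Icc)"
    using differentiable_on_deriv_unit[OF C_class_differentiable[OF s C(2)] kx] bij
    by (simp add: bij_betw_def)
  from DERIV_image_chain[OF this dk]
  have "((\<lambda>x. ?g (k x)) has_real_derivative deriv_unit ?g (k x) * deriv_unit k x) (at x within unit_Icc)"
    by (simp add: o_def)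
  then have "deriv_unit (\<lambda>x. ?g (k x)) x = deriv_unit ?g (k x) * deriv_unit k x"
    by (rule deriv_unit_eqI[OF x])
  moreover have "deriv_unit (\<lambda>x. ?g (k x)) x = deriv_unit (\<lambda>x. x) x"
    by (rule deriv_unit_cong[OF _ x]) (use bij in \<open>auto simp: bij_betw_def\<close>)
  moreover have "deriv_unit (\<lambda>x :: real. x) x = 1"
    by (rule deriv_unit_eqI[OF x]) (auto intro!: derivative_eq_intros)
  ultimately show "deriv_unit k x \<noteq> 0" by auto
qed

lemma not_conjugated_gap_IFS:
  assumes c: "0 < c" "c < 1/2" and s: "1 \<le> s" and h: "gap_diffeo c s h"
    and nontriv: "\<exists>x\<in>unit_Icc. h x \<noteq> x"
  shows "\<not> conjugated_to_self_similar s (gap_IFS c h (\<lambda>x. x))"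
proof
  assume "conjugated_to_self_similar s (gap_IFS c h (\<lambda>x. x))"
  then obtain \<Psi> k where \<Psi>: "hyperbolic_IFS s \<Psi>" "self_similar \<Psi>" and k: "C_diffeo s k"
    and conj: "(\<lambda>g. restrict g unit_Icc) ` \<Psi> =
     (\<lambda>f. restrict (k \<circ> f \<circ> inv_into unit_Icc k) unit_Icc) ` gap_IFS c h (\<lambda>x. x)"
    unfolding conjugated_to_self_similar_def C_conjugated_def by blast
  obtain g0 g1 where g: "\<Psi> = {g0, g1}" "g0 0 = 0" "g0 0 < g0 1" "g0 1 < g1 0" "g1 0 < g1 1" "g1 1 = 1"
    using \<Psi>(1) unfolding hyperbolic_IFS_def by metis
  obtain a b0 where g0: "\<And>x. x \<in> unit_Icc \<Longrightarrow> g0 x = a * x + b0"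
    using \<Psi>(2) g(1) unfolding self_similar_def by blast
  obtain b b1 where g1: "\<And>x. x \<in> unit_Icc \<Longrightarrow> g1 x = b * x + b1"
    using \<Psi>(2) g(1) unfolding self_similar_def by blast
  have b0: "b0 = 0" and b1: "b1 = 1 - b" using g(2,6) g0[of 0] g1[of 1] by auto
  have ab: "a \<noteq> 1" "b \<noteq> 1" using g(2-6) g0[of 1] g1[of 0] b0 b1 by auto
  let ?f0 = "\<lambda>x. c * h x" and ?f1 = "\<lambda>x. c * x + (1 - c)"
  have bij: "bij_betw k unit_Icc unit_Icc" using k by (simp add: C_diffeo_def)
  have semi: "k (f x) = g' (k x)"
    if "restrict g' unit_Icc = restrict (k \<circ> f \<circ> inv_into unit_Icc k) unit_Icc" "x \<in> unit_Icc" for f g' x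
  proof -
    have "k x \<in> unit_Icc" using bij that(2) bij_betwE by blast
    moreover have "inv_into unit_Icc k (k x) = x" using bij that(2) by (simp add: bij_betw_def)
    ultimately show ?thesis using fun_cong[OF that(1), of "k x"] by simp
  qed
  have mem: "k x \<in> unit_Icc" if "x \<in> unit_Icc" for x using bij that bij_betwE by blast
  have d: "(k has_real_derivative deriv_unit k x) (at x within unit_Icc)" "deriv_unit k x \<noteq> 0"
    if "x \<in> unit_Icc" for x using C_diffeo_deriv_nonzero[OF s k that] by auto
  have "{restrict g0 unit_Icc, restrict g1 unit_Icc} =
    {restrict (k \<circ> ?f0 \<circ> inv_into unit_Icc k) unit_Icc, restrict (k \<circ> ?f1 \<circ> inv_into unit_Icc k) unit_Icc}"
    using conj unfolding g(1) gap_IFS_def image_insert image_empty .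
  then consider
    (preserving) "\<forall>x\<in>unit_Icc. k (?f0 x) = g0 (k x) \<and> k (?f1 x) = g1 (k x)"
    | (reversing) "\<forall>x\<in>unit_Icc. k (?f0 x) = g1 (k x) \<and> k (?f1 x) = g0 (k x)"
    unfolding doubleton_eq_iff using semi by blast
  then have "h x = x" if x: "x \<in> unit_Icc" for x
  proof cases
    case preserving
    show ?thesis
      by (rule gap_IFS_linearization_rigid[OF c s h d(1)[of 0] d(2)[of 0] d(1)[of 1] d(2)[of 1] ab _ _ x])
        (use preserving g0 g1 mem b0 b1 in \<open>auto simp: algebra_simps\<close>)
  next
    case reversing
    \<comment> \<open>composition with the reflection exchanges the roles of the two slopes\<close>
    let ?K = "\<lambda>x. 1 - k x"
    have dK: "(?K has_real_derivative - deriv_unit k x) (at x within unit_Icc)" "- deriv_unit k x \<noteq> 0"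
      if "x \<in> unit_Icc" for x
      using d[OF that] by (auto intro!: derivative_eq_intros)
    show ?thesis
      by (rule gap_IFS_linearization_rigid[where k = ?K,
            OF c s h dK(1)[of 0] dK(2)[of 0] dK(1)[of 1] dK(2)[of 1] ab(2,1) _ _ x])
        (use reversing g0 g1 mem b0 b1 in \<open>auto simp: algebra_simps\<close>)
  qed
  then show False using nontriv by blast
qed

theorem theorem2:
  fixes c :: real and s :: ereal
  assumes "0 < c" and "c < 1 / 2" and "1 \<le> s"
  shows "(\<exists>\<Phi>. hyperbolic_IFS s \<Phi> \<and> pseudo_affine c \<Phi> \<and> no_more_regular s \<Phi>) \<and>
         (\<exists>\<Phi>. hyperbolic_IFS s \<Phi> \<and> pseudo_affine c \<Phi> \<and> no_more_regular s \<Phi> \<and>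
              conjugated_to_self_similar s \<Phi>) \<and>
         (\<exists>\<Phi>. hyperbolic_IFS s \<Phi> \<and> pseudo_affine c \<Phi> \<and> no_more_regular s \<Phi> \<and>
              \<not> conjugated_to_self_similar s \<Phi>)"
proof -
  obtain h where h: "gap_diffeo c s h" and nontriv: "\<exists>x\<in>unit_Icc. h x \<noteq> x"
    and irr: "if s = \<infinity> then (\<lambda>x. c * h x) \<notin> C_omega else \<forall>t>s. (\<lambda>x. c * h x) \<notin> C_class t"
    using assms by (rule ex_irregular_gap_diffeo)
  have ident: "gap_diffeo c s (\<lambda>x. x)" using assms(3) by (rule gap_diffeo_ident)
  have IFS: "hyperbolic_IFS s (gap_IFS c h k) \<and> pseudo_affine c (gap_IFS c h k) \<and>
      no_more_regular s (gap_IFS c h k)" if "gap_diffeo c s k" for k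
    using hyperbolic_gap_IFS[OF assms h that] pseudo_affine_gap_IFS[OF assms h that]
      no_more_regular_gap_IFS[OF assms h that irr] by blast
  show ?thesis
    using IFS[OF h] IFS[OF ident] conjugated_gap_IFS[OF assms h]
      not_conjugated_gap_IFS[OF assms h nontriv] by blast
qed

end
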